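(* For every integer $n\geq 2$, the number of new intervals in the Tamari lattice $Y_n$ is $$3\,\frac{2^{n-2}\,(2n-2)!}{(n-1)!\,(n+1)!}.$$
   Context: A planar binary tree is a finite connected simply connected plane graph whose vertices have valence $1$ or $3$, with one distinguished vertex of valence $1$, the root; the other vertices of valence $1$ are the leaves and the vertices of valence $3$ are the internal vertices (leaves drawn at the top, root at the bottom). $Y_n$ ($n\ge 1$) is the set of planar binary trees with $n$ internal vertices (hence $n+1$ leaves); $|$ denotes the trivial tree with one leaf and no internal vertex. For trees $S,T$ (possibly trivial), $S\vee T$ is the tree whose bottom internal vertex has left subtree $S$ and right subtree $T$. Tamari order on $Y_n$: $S\leq T$ if and only if one can pass from $S$ to $T$ by a (possibly empty) sequence of elementary moves, each consisting in replacing, somewhere inside the tree, a subtree of the form $A\vee(B\vee C)$ by $(A\vee B)\vee C$, where $A,B,C$ are planar binary trees, possibly trivial. An interval in $Y_n$ is $[S,T]$ given by a pair $S\leq T$ in $Y_n$; its minimum is $S$ and its maximum is $T$. A plane tree is a finite connected simply connected plane graph whose vertices have valence different from $2$, with a distinguished vertex of valence $1$ called the root; other vertices of valence $1$ are leaves, vertices of valence different from $1$ are internal vertices (leaves at the top, root at the bottom). $P_n$ is the set of plane trees with $n+1$ leaves. Given $T\in P_n$ with at least one internal vertex and, for each internal vertex $s$ of $T$ of valence $v(s)$, an interval $I_s$ in $Y_{v(s)-2}$, the interval $G(T,(I_s)_s)$ in $Y_n$ has as minimum (resp. maximum) the planar binary tree obtained by grafting the minima (resp. the maxima) of the $I_s$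 according to $T$: each internal vertex $s$ is replaced by $\min(I_s)$ (resp. $\max(I_s)$), a binary tree with $v(s)-1$ leaves, its root edge being identified with the edge of $T$ going down from $s$ and its $i$-th leaf edge from the left with the $i$-th edge from the left going up from $s$. An interval is new if it cannot be written as $G(T,(I_s)_s)$ with $T$ a plane tree having at least two internal vertices. *)

theory Defs
  imports Complex_Main
begin

text \<open>A planar binary tree is given by its internal vertices; the root edge is implicit.
  \<open>Leaf\<close> is the trivial tree and \<open>Node S T\<close> is the tree with left subtree \<open>S\<close> and right
  subtree \<open>T\<close>.\<close>

datatype bintree = Leaf | Node bintree bintree

fun internal_vertices :: "bintree \<Rightarrow> nat" where
  "internal_vertices Leaf = 0"
| "internal_vertices (Node S T) = internal_vertices S + internal_vertices T + 1"

fun leaves :: "bintree \<Rightarrow> nat" where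
  "leaves Leaf = 1"
| "leaves (Node S T) = leaves S + leaves T"

definition Y :: "nat \<Rightarrow> bintree set" where
  "Y n = {T. internal_vertices T = n}"

inductive elementary_move :: "bintree \<Rightarrow> bintree \<Rightarrow> bool" where
  rotate: "elementary_move (Node A (Node B C)) (Node (Node A B) C)"
| left: "elementary_move S S' \<Longrightarrow> elementary_move (Node S T) (Node S' T)"
| right: "elementary_move T T' \<Longrightarrow> elementary_move (Node S T) (Node S T')"

definition tamari_le :: "bintree \<Rightarrow> bintree \<Rightarrow> bool" where
  "tamari_le = elementary_move\<^sup>*\<^sup>*"

type_synonym interval = "bintree \<times> bintree"

definition intervals :: "nat \<Rightarrow> interval set" where
  "intervals n = {(S, T). S \<in> Y n \<and> T \<in> Y n \<and> tamari_le S T}"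

text \<open>Plane trees with a label on each internal vertex: a plane tree \<open>T\<close> together with a
  family \<open>(I\<^sub>s)\<close> indexed by its internal vertices is one term of this type. In
  \<open>Vertex x ts\<close> the list \<open>ts\<close> holds the subtrees above the bottom vertex, from left to
  right, so this vertex has valence \<open>length ts + 1\<close>.\<close>

datatype 'a plane_tree = Tip | Vertex 'a "'a plane_tree list"

fun is_plane_tree :: "'a plane_tree \<Rightarrow> bool" where
  "is_plane_tree Tip = True"
| "is_plane_tree (Vertex x ts) = (length ts \<ge> 2 \<and> (\<forall>t\<in>set ts. is_plane_tree t))"

fun plane_internal_vertices :: "'a plane_tree \<Rightarrow> nat" where
  "plane_internal_vertices Tip = 0"
| "plane_internal_vertices (Vertex x ts) = 1 + sum_list (map plane_internal_vertices ts)"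

text \<open>A vertex of valence \<open>v\<close> carries an interval in \<open>Y (v - 2)\<close>.\<close>

fun interval_labelled :: "interval plane_tree \<Rightarrow> bool" where
  "interval_labelled Tip = True"
| "interval_labelled (Vertex I ts) =
     (I \<in> intervals (length ts - 1) \<and> (\<forall>t\<in>set ts. interval_labelled t))"

text \<open>\<open>graft_leaves S ts\<close> puts the \<open>i\<close>-th tree of \<open>ts\<close> on the \<open>i\<close>-th leaf of \<open>S\<close>; it is only
  meaningful when \<open>length ts = leaves S\<close>.\<close>

fun graft_leaves :: "bintree \<Rightarrow> bintree list \<Rightarrow> bintree" where
  "graft_leaves Leaf ts = hd ts"
| "graft_leaves (Node S T) ts =
     Node (graft_leaves S (take (leaves S) ts)) (graft_leaves T (drop (leaves S) ts))"

fun graft :: "bintree plane_tree \<Rightarrow> bintree" where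
  "graft Tip = Leaf"
| "graft (Vertex S ts) = graft_leaves S (map graft ts)"

definition G :: "interval plane_tree \<Rightarrow> interval" where
  "G T = (graft (map_plane_tree fst T), graft (map_plane_tree snd T))"

definition new_intervals :: "nat \<Rightarrow> interval set" where
  "new_intervals n = {I \<in> intervals n.
     \<not> (\<exists>T. is_plane_tree T \<and> interval_labelled T \<and> plane_internal_vertices T \<ge> 2 \<and> I = G T)}"

end

theory Submission
  imports Defs "HOL-Computational_Algebra.Formal_Power_Series"
begin

text \<open>For a binary tree, record for each internal vertex the first and the last leaf above it, its
  span. An interval \<open>[S, T]\<close> can be written as a grafting along a plane tree with at least two
  internal vertices exactly if \<open>S\<close> and \<open>T\<close> have a common span besides the full one: the spans are
  the places where a tree can be cut in two, and the order is inherited by the pieces because it is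
  the pointwise order of bracket vectors. Hence an interval is new iff \<open>S\<close> and \<open>T\<close> have no
  common proper span (\<open>new_intervals_iff\<close>).

  In a new interval with at least two internal vertices, the bottom vertex of \<open>T\<close> has a trivial
  right subtree. Removing this vertex, and the corresponding vertex on the right spine of \<open>S\<close>,
  leaves an interval \<open>[P \<diamondop> Q, U]\<close> with a marked place on the right spine of its minimum
  (\<open>new_intervals_Suc\<close>). This interval need not be new, but its common spans are nested and all reach
  the last leaf; so it is a sequence of new intervals, each grafted on the last leaf of the previous
  one, the mark being in the last of them (\<open>new_cuts_decompose\<close>). For the generating series \<open>N x\<close> of
  new intervals, with \<open>t\<close> counting internal vertices and \<open>x\<close> the right spine of the minimum, this
  means \<open>N x = t x + t x\<^sup>2 (N x - N 1) / ((x - 1) (1 - N x))\<close>.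

  The equation has only one solution with coefficients continuous at \<open>x = 1\<close>
  (\<open>catalytic_equation_unique\<close>), and an algebraic one is written down in terms of series \<open>s\<close> and
  \<open>u\<close> with \<open>s = t + 2 s\<^sup>2\<close> and \<open>u = s (1 - s) x + u\<^sup>2\<close> (\<open>catalytic_identity\<close>). At \<open>x = 1\<close> it gives
  \<open>8 t N 1 = t - s + 8 t s + 2 t\<^sup>2\<close>. The coefficients of \<open>s\<close> are Catalan numbers times powers of two,
  and the formula follows.\<close>

section \<open>Binary trees and the Tamari order\<close>

abbreviation nodes :: "bintree \<Rightarrow> nat" where
  "nodes \<equiv> internal_vertices"

lemma leaves_eq_Suc_nodes: "leaves T = Suc (nodes T)"
  by (induction T) auto

lemma nodes_eq_0_iff [simp]: "nodes T = 0 \<longleftrightarrow> T = Leaf"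
  by (cases T) auto

text \<open>The internal vertices are listed from left to right, leaves are numbered from left to
  right starting with \<open>p\<close>, and the entry of a vertex is the number of the first leaf above it.
  This is the bracket vector of the tree, shifted so that grafting acts on it by an increasing
  function of the entries; the Tamari order is the reversed pointwise order of these lists
  (\<open>tamari_le_iff_starts\<close>).\<close>
fun starts :: "nat \<Rightarrow> bintree \<Rightarrow> nat list" where
  "starts p Leaf = []"
| "starts p (Node L R) = starts p L @ p # starts (p + nodes L + 1) R"

lemma length_starts [simp]: "length (starts p T) = nodes T"
  by (induction T arbitrary: p) auto

lemma starts_bounds: "i \<in> set (starts p T) \<Longrightarrow> p \<le> i \<and> i < p + nodes T"
  by (induction T arbitrary: p) fastforce+

text \<open>Grafting on the last leaf makes the binary trees a free monoid, a tree being the word of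
  the left subtrees along its right spine. The next two lemmas are its cancellation laws: Levi's
  lemma, and its special case for factors of equal size.\<close>
fun graft_right :: "bintree \<Rightarrow> bintree \<Rightarrow> bintree" (infixr "\<diamondop>" 65) where
  "Leaf \<diamondop> Q = Q"
| "Node A B \<diamondop> Q = Node A (B \<diamondop> Q)"

lemma nodes_graft_right [simp]: "nodes (P \<diamondop> Q) = nodes P + nodes Q"
  by (induction P) auto

lemma graft_right_assoc [simp]: "(P \<diamondop> Q) \<diamondop> R = P \<diamondop> (Q \<diamondop> R)"
  by (induction P) auto

lemma graft_right_Leaf [simp]: "P \<diamondop> Leaf = P"
  by (induction P) auto

lemma graft_right_eq_Leaf_iff [simp]: "P \<diamondop> Q = Leaf \<longleftrightarrow> P = Leaf \<and> Q = Leaf"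
  by (cases P) auto

lemma starts_graft_right: "starts p (P \<diamondop> Q) = starts p P @ starts (p + nodes P) Q"
  by (induction P arbitrary: p) (auto simp: add_ac)

lemma graft_right_split:
  "P \<diamondop> Q = P' \<diamondop> Q' \<Longrightarrow> nodes P \<le> nodes P' \<Longrightarrow> \<exists>X. P' = P \<diamondop> X \<and> Q = X \<diamondop> Q'"
proof (induction P arbitrary: P')
  case Leaf
  then show ?case by simp
next
  case (Node A B)
  show ?case
  proof (cases P')
    case Leaf
    with Node.prems(2) show ?thesis by simp
  next
    case (Node A' B')
    with Node.prems Node.IH(2)[of B'] show ?thesis by auto
  qed
qed

lemma graft_right_inject:
  assumes "P \<diamondop> Q = P' \<diamondop> Q'" "nodes P = nodes P'"
  shows "P = P' \<and> Q = Q'"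
proof -
  from assms obtain X where X: "P' = P \<diamondop> X" "Q = X \<diamondop> Q'"
    using graft_right_split[of P Q P' Q'] by auto
  with assms(2) have "X = Leaf" by simp
  with X show ?thesis by simp
qed

lemma elementary_move_nodes: "elementary_move S T \<Longrightarrow> nodes S = nodes T"
  by (induction rule: elementary_move.induct) auto

lemma tamari_le_nodes: "tamari_le S T \<Longrightarrow> nodes S = nodes T"
  unfolding tamari_le_def
  by (induction rule: rtranclp_induct) (auto dest: elementary_move_nodes)

text \<open>A move at \<open>Node A (Node B C)\<close> changes only the entry of the upper vertex, which drops to
  the first leaf of \<open>A\<close>.\<close>
lemma elementary_move_starts:
  "elementary_move S T \<Longrightarrow> list_all2 (\<ge>) (starts p S) (starts p T)"
proof (induction arbitrary: p rule: elementary_move.induct)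
  case (rotate A B C)
  have r: "list_all2 (\<ge>) xs xs" for xs :: "nat list"
    by (rule list_all2_refl) simp
  show ?case
    by (auto intro!: list_all2_appendI r simp: add_ac)
next
  case (left S S' T)
  then show ?case
    by (auto intro!: list_all2_appendI list_all2_refl dest: elementary_move_nodes)
next
  case (right T T' S)
  then show ?case
    by (auto intro!: list_all2_appendI list_all2_refl)
qed

lemma tamari_le_starts: "tamari_le S T \<Longrightarrow> list_all2 (\<ge>) (starts p S) (starts p T)"
  unfolding tamari_le_def
proof (induction rule: rtranclp_induct)
  case base
  show ?case by (rule list_all2_refl) simp
next
  case (step T U)
  show ?case
    by (rule list_all2_trans[OF _ step(3) elementary_move_starts[OF step(2)]]) simp
qed

lemma tamari_le_Node:
  assumes "tamari_le S S'" "tamari_le T T'"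
  shows "tamari_le (Node S T) (Node S' T')"
proof -
  have "tamari_le (Node S T) (Node S' T)"
    using assms(1) unfolding tamari_le_def
    by (induction rule: rtranclp_induct) (auto intro: rtranclp.rtrancl_into_rtrancl left)
  moreover have "tamari_le (Node S' T) (Node S' T')"
    using assms(2) unfolding tamari_le_def
    by (induction rule: rtranclp_induct) (auto intro: rtranclp.rtrancl_into_rtrancl right)
  ultimately show ?thesis unfolding tamari_le_def by simp
qed

lemma tamari_le_trans: "tamari_le S T \<Longrightarrow> tamari_le T U \<Longrightarrow> tamari_le S U"
  unfolding tamari_le_def by simp

lemma tamari_le_refl [simp]: "tamari_le S S"
  unfolding tamari_le_def by simp

text \<open>The vertex carrying \<open>Q\<close> and \<open>R\<close> sits on the right spine; rotating it past the vertices
  of \<open>P\<close> one at a time brings it to the bottom.\<close>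
lemma tamari_le_raise: "tamari_le (P \<diamondop> Node Q R) (Node (P \<diamondop> Q) R)"
proof (induction P)
  case Leaf
  show ?case by simp
next
  case (Node A B)
  have "tamari_le (Node A (B \<diamondop> Node Q R)) (Node A (Node (B \<diamondop> Q) R))"
    by (rule tamari_le_Node) (use Node in auto)
  moreover have "tamari_le (Node A (Node (B \<diamondop> Q) R)) (Node (Node A (B \<diamondop> Q)) R)"
    unfolding tamari_le_def by (intro r_into_rtranclp rotate)
  ultimately show ?case using tamari_le_trans by simp
qed

text \<open>No vertex to the right of \<open>e\<close> starts at or before the leaf just left of \<open>e\<close>, so none of
  them has \<open>e\<close> in its left subtree. Every ancestor of \<open>e\<close> therefore lies to its left, that is,
  \<open>e\<close> is on the right spine.\<close>
lemma starts_cut: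
  assumes "starts p S = v @ e # w" and "\<forall>i\<in>set w. p + length v < i"
  obtains P Q R where "S = P \<diamondop> Node Q R" "starts p (P \<diamondop> Q) = v"
    "starts (p + length v + 1) R = w"
  using assms
proof (induction S arbitrary: p v thesis)
  case Leaf
  then show ?case by simp
next
  case (Node A B)
  let ?B = "starts (p + nodes A + 1) B"
  have eq: "starts p A @ p # ?B = v @ e # w" using Node.prems(2) by simp
  consider "nodes A = length v" | "nodes A < length v" | "length v < nodes A" by linarith
  then show ?case
  proof cases
    case 1
    then have "starts p A = v" "?B = w" using eq by (auto simp: append_eq_append_conv)
    with 1 show ?thesis using Node.prems(1)[of Leaf A B] by simp
  next
    case 2
    from eq obtain us where us: "starts p A @ us = v \<and> p # ?B = us @ e # w \<or>
        starts p A = v @ us \<and> us @ p # ?B = e # w"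
      unfolding append_eq_append_conv2 by blast
    with 2 have "starts p A @ us = v" "p # ?B = us @ e # w"
      by (auto dest: arg_cong[where f = length])
    with 2 obtain us' where us': "us = p # us'" "?B = us' @ e # w"
      by (cases us) auto
    then have v: "v = starts p A @ p # us'" using \<open>starts p A @ us = v\<close> by simp
    have "\<forall>i\<in>set w. (p + nodes A + 1) + length us' < i"
      using Node.prems(3) v by auto
    from Node.IH(2)[OF _ us'(2) this] obtain P Q R where
      "B = P \<diamondop> Node Q R" "starts (p + nodes A + 1) (P \<diamondop> Q) = us'"
      "starts (p + nodes A + 1 + length us' + 1) R = w" by blast
    with v show ?thesis using Node.prems(1)[of "Node A P" Q R] by (simp add: add_ac)
  next
    case 3
    have "p \<in> set w"
    proof -
      have "w = drop (Suc (length v)) (starts p A @ p # ?B)" by (subst eq) simp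
      with 3 show ?thesis by simp
    qed
    with Node.prems(3) show ?thesis by auto
  qed
qed

lemma starts_Node_cut:
  assumes "list_all2 (\<ge>) (starts p S) (starts p (Node U V))"
  obtains P Q R where "S = P \<diamondop> Node Q R"
    "list_all2 (\<ge>) (starts p (P \<diamondop> Q)) (starts p U)"
    "list_all2 (\<ge>) (starts (p + nodes U + 1) R) (starts (p + nodes U + 1) V)"
proof -
  from assms obtain v e w where S: "starts p S = v @ e # w"
    and v: "list_all2 (\<ge>) v (starts p U)"
    and w: "list_all2 (\<ge>) w (starts (p + nodes U + 1) V)"
    by (auto simp: list_all2_append2 list_all2_Cons2)
  have len: "length v = nodes U" using v by (simp add: list_all2_lengthD)
  have "\<forall>i\<in>set w. p + length v < i"
  proof
    fix i assume "i \<in> set w"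
    then obtain k where k: "k < length w" "i = w ! k" by (auto simp: in_set_conv_nth)
    then have "starts (p + nodes U + 1) V ! k \<le> i" "k < length (starts (p + nodes U + 1) V)"
      using w by (auto simp: list_all2_conv_all_nth)
    with starts_bounds[OF nth_mem[OF this(2)]] len show "p + length v < i" by simp
  qed
  from starts_cut[OF S this] v w len that show ?thesis by metis
qed

text \<open>Induction on the larger tree: the vertex of \<open>S\<close> in the position of the bottom vertex of
  \<open>Node U V\<close> lies on the right spine of \<open>S\<close>, and raising it to the bottom leaves two smaller
  comparisons.\<close>
lemma tamari_leI: "list_all2 (\<ge>) (starts p S) (starts p T) \<Longrightarrow> tamari_le S T"
proof (induction T arbitrary: p S)
  case Leaf
  then have "length (starts p S) = 0" by simp
  then have "S = Leaf" by simp
  then show ?case by simp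
next
  case (Node U V)
  from starts_Node_cut[OF Node.prems] obtain P Q R where S: "S = P \<diamondop> Node Q R" and
    "list_all2 (\<ge>) (starts p (P \<diamondop> Q)) (starts p U)"
    "list_all2 (\<ge>) (starts (p + nodes U + 1) R) (starts (p + nodes U + 1) V)" by blast
  then have "tamari_le (Node (P \<diamondop> Q) R) (Node U V)"
    by (intro tamari_le_Node Node.IH)
  then show ?case unfolding S by (rule tamari_le_trans[OF tamari_le_raise])
qed

lemma tamari_le_iff_starts: "tamari_le S T \<longleftrightarrow> list_all2 (\<ge>) (starts p S) (starts p T)"
  by (rule iffI[OF tamari_le_starts tamari_leI])

lemma tamari_le_NodeE:
  assumes "tamari_le S (Node U V)"
  obtains P Q R where "S = P \<diamondop> Node Q R" "tamari_le (P \<diamondop> Q) U" "tamari_le R V"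
  by (rule starts_Node_cut[OF tamari_le_starts[OF assms, of 0]]) (blast dest: tamari_leI)

lemma tamari_le_raiseI:
  "tamari_le (P \<diamondop> Q) U \<Longrightarrow> tamari_le R V \<Longrightarrow> tamari_le (P \<diamondop> Node Q R) (Node U V)"
  by (rule tamari_le_trans[OF tamari_le_raise tamari_le_Node])

text \<open>Grafting on the last leaf concatenates the lists of starts, so it neither creates nor
  destroys comparisons.\<close>
lemma tamari_le_graft_right_iff:
  assumes "nodes P = nodes U"
  shows "tamari_le (P \<diamondop> Q) (U \<diamondop> V) \<longleftrightarrow> tamari_le P U \<and> tamari_le Q V"
  using assms unfolding tamari_le_iff_starts[of "P \<diamondop> Q" _ 0] tamari_le_iff_starts[of P _ 0]
    tamari_le_iff_starts[of Q _ "nodes P"]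
  by (auto simp: starts_graft_right list_all2_append)

section \<open>Spans and substitution at a leaf\<close>

text \<open>A subtree is remembered by its first and last leaf only. A common element of
  \<open>spans 0 S\<close> and \<open>spans 0 T\<close> is a place where both trees can be cut simultaneously.\<close>
fun spans :: "nat \<Rightarrow> bintree \<Rightarrow> (nat \<times> nat) set" where
  "spans p Leaf = {}"
| "spans p (Node L R) =
     insert (p, p + nodes L + nodes R + 1) (spans p L \<union> spans (p + nodes L + 1) R)"

lemma spans_bounds: "(a, b) \<in> spans p T \<Longrightarrow> p \<le> a \<and> a < b \<and> b \<le> p + nodes T"
  by (induction T arbitrary: p) fastforce+

lemma root_span: "T \<noteq> Leaf \<Longrightarrow> (p, p + nodes T) \<in> spans p T"
  by (cases T) (auto simp: add_ac)

text \<open>Substitution of \<open>X\<close> for the leaf numbered \<open>a\<close>, when the first leaf has number \<open>p\<close>.\<close>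
fun plug :: "nat \<Rightarrow> nat \<Rightarrow> bintree \<Rightarrow> bintree \<Rightarrow> bintree" where
  "plug p a X Leaf = X"
| "plug p a X (Node L R) =
     (if a \<le> p + nodes L then Node (plug p a X L) R else Node L (plug (p + nodes L + 1) a X R))"

lemma nodes_plug [simp]: "nodes (plug p a X S) = nodes S + nodes X"
  by (induction p a X S rule: plug.induct) auto

lemma span_plug:
  assumes "(a, b) \<in> spans p S"
  obtains X S' where "S = plug p a X S'" "b = a + nodes X" "p \<le> a" "a \<le> p + nodes S'" "X \<noteq> Leaf"
  using assms
proof (induction S arbitrary: p thesis)
  case Leaf
  then show ?case by simp
next
  case (Node L R)
  from Node.prems(2) consider "(a, b) = (p, p + nodes L + nodes R + 1)" | "(a, b) \<in> spans p L"
    | "(a, b) \<in> spans (p + nodes L + 1) R" by auto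
  then show ?case
  proof cases
    case 1
    with Node.prems(1)[of "Node L R" Leaf] show ?thesis by simp
  next
    case 2
    from Node.IH(1)[OF _ 2] obtain X S' where
      "L = plug p a X S'" "b = a + nodes X" "p \<le> a" "a \<le> p + nodes S'" "X \<noteq> Leaf" by blast
    with Node.prems(1)[of X "Node S' R"] show ?thesis by simp
  next
    case 3
    from Node.IH(2)[OF _ 3] obtain X S' where
      "R = plug (p + nodes L + 1) a X S'" "b = a + nodes X" "p + nodes L + 1 \<le> a"
      "a \<le> p + nodes L + 1 + nodes S'" "X \<noteq> Leaf" by blast
    with Node.prems(1)[of X "Node L S'"] show ?thesis by simp
  qed
qed

text \<open>The effect on leaf numbers of replacing leaf \<open>a\<close> by a tree with \<open>m\<close> internal vertices: the
  subtrees starting at \<open>a\<close> or before keep their first leaf.\<close>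
definition make_room :: "nat \<Rightarrow> nat \<Rightarrow> nat \<Rightarrow> nat" where
  "make_room a m i = (if i \<le> a then i else i + m)"

lemma make_room_le_iff [simp]: "make_room a m i \<le> make_room a m j \<longleftrightarrow> i \<le> j"
  by (auto simp: make_room_def)

lemma starts_plug:
  assumes "p \<le> a" "a \<le> p + nodes S"
  shows "starts p (plug p a X S) =
    map (make_room a (nodes X)) (take (a - p) (starts p S)) @ starts a X @
    map (make_room a (nodes X)) (drop (a - p) (starts p S))"
  using assms
proof (induction S arbitrary: p)
  case Leaf
  then show ?case by simp
next
  case (Node L R)
  have shift: "map (make_room a (nodes X)) (starts q T) = starts (q + nodes X) T" if "a < q" for q T
    using that by (induction T arbitrary: q) (auto simp: make_room_def add_ac)
  have keep: "map (make_room a (nodes X)) (starts q T) = starts q T" if "q + nodes T \<le> a" for q T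
    using that starts_bounds[of _ q T] by (intro map_idI) (force simp: make_room_def)
  have p: "make_room a (nodes X) p = p" using Node.prems by (simp add: make_room_def)
  show ?case
  proof (cases "a \<le> p + nodes L")
    case True
    with Node.IH(1)[of p] Node.prems shift[of "p + nodes L + 1" R] p show ?thesis
      by (simp add: add_ac)
  next
    case False
    then obtain d where d: "a = p + nodes L + 1 + d"
      by (metis add.assoc le_iff_add not_less_eq_eq Suc_eq_plus1)
    with Node.IH(2)[of "p + nodes L + 1"] Node.prems keep[of p L] p show ?thesis
      by simp
  qed
qed

text \<open>Renumbering leaves by \<open>make_room\<close> is strictly increasing, hence preserves and reflects
  the pointwise order. In particular two comparable trees that are cut at a common span
  fall into comparable pieces.\<close>
lemma tamari_le_plug_iff:
  assumes "a \<le> nodes S" "nodes S = nodes T" "nodes X = nodes Z"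
  shows "tamari_le (plug 0 a X S) (plug 0 a Z T) \<longleftrightarrow> tamari_le S T \<and> tamari_le X Z"
proof -
  define f where "f = map (make_room a (nodes X))"
  have f: "list_all2 (\<ge>) (f xs) (f ys) \<longleftrightarrow> list_all2 (\<ge>) xs ys" for xs ys
    by (simp add: f_def list_all2_conv_all_nth cong: conj_cong)
  have len: "length (f xs) = length xs" for xs by (simp add: f_def)
  let ?S1 = "take a (starts 0 S)" and ?S2 = "drop a (starts 0 S)"
  let ?T1 = "take a (starts 0 T)" and ?T2 = "drop a (starts 0 T)"
  have l: "length ?S1 = length ?T1" using assms by simp
  have S: "starts 0 (plug 0 a X S) = f ?S1 @ starts a X @ f ?S2"
    using assms by (simp add: starts_plug f_def)
  have T: "starts 0 (plug 0 a Z T) = f ?T1 @ starts a Z @ f ?T2"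
    using assms by (simp add: starts_plug f_def)
  have "tamari_le (plug 0 a X S) (plug 0 a Z T) \<longleftrightarrow>
      list_all2 (\<ge>) (f ?S1 @ starts a X @ f ?S2) (f ?T1 @ starts a Z @ f ?T2)"
    by (simp only: tamari_le_iff_starts[where p = 0] S T)
  also have "\<dots> \<longleftrightarrow> list_all2 (\<ge>) (f ?S1) (f ?T1) \<and>
      list_all2 (\<ge>) (starts a X @ f ?S2) (starts a Z @ f ?T2)"
    using l by (intro list_all2_append) (simp only: len)
  also have "list_all2 (\<ge>) (starts a X @ f ?S2) (starts a Z @ f ?T2) \<longleftrightarrow>
      list_all2 (\<ge>) (starts a X) (starts a Z) \<and> list_all2 (\<ge>) (f ?S2) (f ?T2)"
    using assms by (intro list_all2_append) simp
  also have "list_all2 (\<ge>) (f ?S1) (f ?T1) \<and>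
      list_all2 (\<ge>) (starts a X) (starts a Z) \<and> list_all2 (\<ge>) (f ?S2) (f ?T2)
    \<longleftrightarrow> list_all2 (\<ge>) (?S1 @ ?S2) (?T1 @ ?T2) \<and> list_all2 (\<ge>) (starts a X) (starts a Z)"
    unfolding f list_all2_append[OF l] by blast
  also have "\<dots> \<longleftrightarrow> tamari_le S T \<and> tamari_le X Z"
    by (simp only: append_take_drop_id tamari_le_iff_starts[of S T 0] tamari_le_iff_starts[of X Z a])
  finally show ?thesis .
qed

section \<open>New intervals are those without a common proper span\<close>

lemma graft_leaves_replicate: "graft_leaves S (replicate (leaves S) Leaf) = S"
  by (induction S) auto

lemma graft_leaves_plug:
  assumes "p \<le> a" "a \<le> p + nodes S"
  shows "graft_leaves S (replicate (a - p) Leaf @ X # replicate (p + nodes S - a) Leaf) = plug p a X S"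
  using assms
proof (induction S arbitrary: p)
  case Leaf
  then show ?case by simp
next
  case (Node L R)
  let ?ts = "replicate (a - p) Leaf @ X # replicate (p + nodes (Node L R) - a) Leaf"
  show ?case
  proof (cases "a \<le> p + nodes L")
    case True
    define j l where "j = a - p" and "l = p + nodes L - a"
    have jl: "a - p = j" "p + nodes L - a = l" "leaves L = Suc (j + l)"
      "p + nodes (Node L R) - a = l + leaves R"
      using True Node.prems by (auto simp: j_def l_def leaves_eq_Suc_nodes)
    have "take (leaves L) ?ts = replicate j Leaf @ X # replicate l Leaf"
      "drop (leaves L) ?ts = replicate (leaves R) Leaf"
      unfolding jl by (simp_all add: replicate_add)
    with True Node.IH(1)[of p] Node.prems jl show ?thesis
      by (simp add: graft_leaves_replicate)
  next
    case False
    define j where "j = a - (p + nodes L + 1)"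
    have j: "a - p = leaves L + j" "a - (p + nodes L + 1) = j"
      "p + nodes (Node L R) - a = p + nodes L + 1 + nodes R - a"
      using False Node.prems by (auto simp: j_def leaves_eq_Suc_nodes)
    have "take (leaves L) ?ts = replicate (leaves L) Leaf"
      "drop (leaves L) ?ts = replicate j Leaf @ X # replicate (p + nodes L + 1 + nodes R - a) Leaf"
      unfolding j by (simp_all add: replicate_add)
    with False Node.IH(2)[of "p + nodes L + 1"] Node.prems j show ?thesis
      by (simp add: graft_leaves_replicate)
  qed
qed

lemma leaves_graft_leaves:
  "length ts = leaves S \<Longrightarrow> leaves (graft_leaves S ts) = sum_list (map leaves ts)"
proof (induction S arbitrary: ts)
  case Leaf
  then show ?case by (cases ts) auto
next
  case (Node L R)
  have "sum_list (map leaves (take (leaves L) ts)) + sum_list (map leaves (drop (leaves L) ts))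
      = sum_list (map leaves ts)"
    by (metis append_take_drop_id map_append sum_list_append)
  with Node show ?case by simp
qed

lemma spans_graft_leaves:
  assumes "length ts = leaves S" "i < length ts"
  shows "spans (p + sum_list (map leaves (take i ts))) (ts ! i) \<subseteq> spans p (graft_leaves S ts)"
  using assms
proof (induction S arbitrary: p ts i)
  case Leaf
  then show ?case by (cases ts) auto
next
  case (Node L R)
  show ?case
  proof (cases "i < leaves L")
    case True
    with Node.IH(1)[of "take (leaves L) ts" i p] Node.prems show ?thesis
      by (auto simp: min_absorb1 min_absorb2 leaves_eq_Suc_nodes split: if_splits)
  next
    case False
    then obtain d where d: "i = leaves L + d" by (metis le_iff_add not_less)
    have l: "nodes (graft_leaves L (take (leaves L) ts)) + 1 = sum_list (map leaves (take (leaves L) ts))"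
      using leaves_graft_leaves[of "take (leaves L) ts" L] Node.prems
      by (simp add: leaves_eq_Suc_nodes)
    have "take i ts = take (leaves L) ts @ take d (drop (leaves L) ts)"
      by (simp add: d take_add)
    with Node.IH(2)[of "drop (leaves L) ts" d "p + sum_list (map leaves (take (leaves L) ts))"]
      Node.prems d l show ?thesis
      by (simp add: add_ac) blast
  qed
qed

lemma intervals_D:
  "I \<in> intervals n \<Longrightarrow> nodes (fst I) = n \<and> nodes (snd I) = n \<and> tamari_le (fst I) (snd I)"
  by (auto simp: intervals_def Y_def)

lemma interval_iff: "(S, T) \<in> intervals n \<longleftrightarrow> nodes T = n \<and> tamari_le S T"
  by (auto simp: intervals_def Y_def dest: tamari_le_nodes)

text \<open>The leaves are those of the plane tree, so minimum and maximum of a grafted interval have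
  their subtrees at the same places.\<close>
lemma leaves_graft_fst_snd:
  assumes "is_plane_tree P" "interval_labelled P"
  shows "leaves (graft (map_plane_tree fst P)) = leaves (graft (map_plane_tree snd P))"
  using assms
proof (induction P)
  case Tip
  then show ?case by simp
next
  case (Vertex I ts)
  have "length ts = leaves (fst I)" "length ts = leaves (snd I)"
    using Vertex.prems by (auto simp: leaves_eq_Suc_nodes dest!: intervals_D)
  moreover have "map (\<lambda>t. leaves (graft (map_plane_tree fst t))) ts
      = map (\<lambda>t. leaves (graft (map_plane_tree snd t))) ts"
    using Vertex by (intro map_cong) auto
  ultimately show ?case by (simp add: leaves_graft_leaves comp_def del: map_eq_conv)
qed

lemma graft_neq_Leaf:
  assumes "is_plane_tree P" "interval_labelled P" "plane_internal_vertices P > 0" "f = fst \<or> f = snd"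
  shows "graft (map_plane_tree f P) \<noteq> Leaf"
proof (cases P)
  case (Vertex I ts)
  have "f I \<noteq> Leaf" using assms Vertex by (auto dest!: intervals_D)
  with Vertex show ?thesis by (cases "f I") auto
qed (use assms in auto)

text \<open>A plane tree with at least two internal vertices has an internal vertex directly above the
  bottom one; what is grafted there is a proper subtree, at the same place in \<open>S\<close> and \<open>T\<close>.\<close>
lemma graft_common_span:
  assumes "is_plane_tree P" "interval_labelled P" "plane_internal_vertices P \<ge> 2"
    and "G P = (S, T)"
  obtains a b where "(a, b) \<in> spans 0 S" "(a, b) \<in> spans 0 T" "(a, b) \<noteq> (0, nodes S)"
proof -
  from assms(3) obtain I ts where P: "P = Vertex I ts" by (cases P) auto
  have len: "length ts = leaves (fst I)" "length ts = leaves (snd I)" "length ts \<ge> 2"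
    using assms(1,2) P by (auto simp: leaves_eq_Suc_nodes dest!: intervals_D)
  have ts: "is_plane_tree t" "interval_labelled t" if "t \<in> set ts" for t
    using assms(1,2) P that by auto
  have "plane_internal_vertices P = 1 + sum_list (map plane_internal_vertices ts)"
    using P by simp
  then have "sum_list (map plane_internal_vertices ts) \<noteq> 0" using assms(3) by linarith
  then obtain t where "t \<in> set ts" "plane_internal_vertices t \<noteq> 0"
    by (auto simp: sum_list_eq_0_iff)
  then obtain i where i: "i < length ts" "plane_internal_vertices (ts ! i) > 0"
    by (auto simp: in_set_conv_nth)
  let ?s = "map (\<lambda>t. graft (map_plane_tree fst t)) ts"
  let ?t = "map (\<lambda>t. graft (map_plane_tree snd t)) ts"
  have S: "S = graft_leaves (fst I) ?s" and T: "T = graft_leaves (snd I) ?t"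
    using assms(4) P by (auto simp: G_def comp_def)
  have l: "map leaves ?s = map leaves ?t"
    using leaves_graft_fst_snd ts by auto
  define a where "a = sum_list (map leaves (take i ?s))"
  have a': "a = sum_list (map leaves (take i ?t))"
    unfolding a_def take_map using l by (metis take_map)
  have ni: "nodes (?s ! i) = nodes (?t ! i)"
    using leaves_graft_fst_snd[of "ts ! i"] ts i by (simp add: leaves_eq_Suc_nodes)
  have "(a, a + nodes (?s ! i)) \<in> spans a (?s ! i)" "(a, a + nodes (?t ! i)) \<in> spans a (?t ! i)"
    using i ts graft_neq_Leaf[of "ts ! i"] by (auto intro!: root_span)
  then have "(a, a + nodes (?s ! i)) \<in> spans 0 S" "(a, a + nodes (?s ! i)) \<in> spans 0 T"
    using spans_graft_leaves[of ?s "fst I" i 0] spans_graft_leaves[of ?t "snd I" i 0] len i ni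
    unfolding S T a_def[symmetric] a'[symmetric] by auto
  moreover have "(a, a + nodes (?s ! i)) \<noteq> (0, nodes S)" if "nodes (?s ! i) < nodes S"
    using that by auto
  moreover have "nodes (?s ! i) < nodes S"
  proof -
    have ge: "length xs \<le> sum_list (map leaves xs)" for xs :: "bintree list"
      by (induction xs) (auto simp: leaves_eq_Suc_nodes)
    have "?s = take i ?s @ ?s ! i # drop (Suc i) ?s"
      using i by (intro id_take_nth_drop) simp
    then have "sum_list (map leaves ?s) =
        sum_list (map leaves (take i ?s)) + (leaves (?s ! i) + sum_list (map leaves (drop (Suc i) ?s)))"
      by (metis (no_types) list.simps(9) map_append sum_list.Cons sum_list_append)
    moreover have "i \<le> sum_list (map leaves (take i ?s))"
      "length ts - Suc i \<le> sum_list (map leaves (drop (Suc i) ?s))"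
      using ge[of "take i ?s"] ge[of "drop (Suc i) ?s"] i by (auto simp: min_def)
    moreover have "leaves S = sum_list (map leaves ?s)"
      unfolding S using len by (intro leaves_graft_leaves) simp
    ultimately show ?thesis using len i unfolding leaves_eq_Suc_nodes by linarith
  qed
  ultimately show ?thesis using that by blast
qed

text \<open>Conversely a common span cuts both trees in two, and the two resulting intervals label a
  plane tree with exactly two internal vertices.\<close>
lemma common_span_graft:
  assumes "(S, T) \<in> intervals n" "(a, b) \<in> spans 0 S" "(a, b) \<in> spans 0 T" "(a, b) \<noteq> (0, n)"
  obtains P where "is_plane_tree P" "interval_labelled P" "plane_internal_vertices P \<ge> 2"
    "G P = (S, T)"
proof -
  from span_plug[OF assms(2)] obtain X S' where
    S: "S = plug 0 a X S'" "b = a + nodes X" "a \<le> nodes S'" "X \<noteq> Leaf" by auto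
  from span_plug[OF assms(3)] obtain Z T' where
    T: "T = plug 0 a Z T'" "b = a + nodes Z" "a \<le> nodes T'" "Z \<noteq> Leaf" by auto
  have n: "nodes S = n" "nodes T = n" "tamari_le S T"
    using intervals_D[OF assms(1)] by auto
  have XZ: "nodes X = nodes Z" "nodes S' = nodes T'" using S T n by auto
  with n(3) S T have le: "tamari_le S' T'" "tamari_le X Z"
    using tamari_le_plug_iff[of a S' T' X Z] by auto
  have S': "nodes S' > 0" using assms(4) S n by (cases "nodes S' = 0") auto
  define W where "W = Vertex (X, Z) (replicate (leaves X) Tip)"
  define P where "P = Vertex (S', T') (replicate a Tip @ W # replicate (nodes S' - a) Tip)"
  show ?thesis
  proof
    have "nodes X > 0" using S(4) by (cases X) auto
    with S' S show "is_plane_tree P" by (auto simp: P_def W_def leaves_eq_Suc_nodes)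
    show "interval_labelled P" using S XZ le by (auto simp: P_def W_def interval_iff leaves_eq_Suc_nodes)
    show "plane_internal_vertices P \<ge> 2" by (auto simp: P_def W_def sum_list_replicate)
    have "leaves X = leaves Z" using XZ by (simp add: leaves_eq_Suc_nodes)
    then have "graft (map_plane_tree fst W) = X" "graft (map_plane_tree snd W) = Z"
      unfolding W_def using graft_leaves_replicate[of X] graft_leaves_replicate[of Z]
      by (auto simp: map_replicate_const simp del: replicate_Suc)
    then show "G P = (S, T)"
      unfolding G_def P_def using graft_leaves_plug[of 0 a S' X] graft_leaves_plug[of 0 a T' Z] S T XZ
      by simp
  qed
qed

lemma new_intervals_iff:
  "(S, T) \<in> new_intervals n \<longleftrightarrow>
     nodes T = n \<and> tamari_le S T \<and> spans 0 S \<inter> spans 0 T \<subseteq> {(0, n)}"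
proof -
  have "(\<exists>P. is_plane_tree P \<and> interval_labelled P \<and> plane_internal_vertices P \<ge> 2 \<and> (S, T) = G P)
      \<longleftrightarrow> \<not> spans 0 S \<inter> spans 0 T \<subseteq> {(0, n)}" (is "?l \<longleftrightarrow> ?r") if "(S, T) \<in> intervals n"
  proof
    assume ?l
    then obtain a b where "(a, b) \<in> spans 0 S" "(a, b) \<in> spans 0 T" "(a, b) \<noteq> (0, nodes S)"
      by (metis graft_common_span)
    with intervals_D[OF that] show ?r by auto
  next
    assume ?r
    then obtain c where "c \<in> spans 0 S" "c \<in> spans 0 T" "c \<noteq> (0, n)" by blast
    with that show ?l by (cases c) (metis common_span_graft)
  qed
  then show ?thesis by (auto simp: new_intervals_def interval_iff)
qed


section \<open>Removing the bottom vertex of the maximum\<close>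

fun right_spine :: "bintree \<Rightarrow> nat" where
  "right_spine Leaf = 0"
| "right_spine (Node L R) = Suc (right_spine R)"

lemma right_spine_graft_right [simp]: "right_spine (P \<diamondop> Q) = right_spine P + right_spine Q"
  by (induction P) auto

lemma spans_shift: "(a + c, b + c) \<in> spans (p + c) T \<longleftrightarrow> (a, b) \<in> spans p T"
proof (induction T arbitrary: p)
  case Leaf
  show ?case by simp
next
  case (Node L R)
  have "p + c + nodes L + 1 = p + nodes L + 1 + c" by simp
  with Node.IH(1)[of p] Node.IH(2)[of "p + nodes L + 1"] show ?case
    by (simp only: spans.simps) auto
qed

lemma spans_shift0: "(a + c, b + c) \<in> spans c T \<longleftrightarrow> (a, b) \<in> spans 0 T"
  using spans_shift[of a c b 0 T] by simp

text \<open>The spans of \<open>P\<close> that reach its last leaf are those extended by \<open>Q\<close>.\<close>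
lemma spans_graft_right:
  "(a, b) \<in> spans p (P \<diamondop> Q) \<longleftrightarrow>
     (a, b) \<in> spans p P \<and> b < p + nodes P \<or>
     (a, b) \<in> spans (p + nodes P) Q \<or>
     (a, p + nodes P) \<in> spans p P \<and> b = p + nodes P + nodes Q"
proof (induction P arbitrary: p)
  case Leaf
  show ?case by simp
next
  case (Node A B)
  have "b < p + nodes (Node A B)" if "(a, b) \<in> spans p A"
    using spans_bounds[OF that] by simp
  moreover have "(a, p + nodes (Node A B)) \<notin> spans p A"
    using spans_bounds[of a "p + nodes (Node A B)" p A] by auto
  moreover have "p + nodes A + 1 + nodes B = p + nodes (Node A B)" by simp
  ultimately show ?case
    using Node.IH(2)[of "p + nodes A + 1"] by (auto simp: add.assoc)
qed

lemma suffix_span_cut: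
  "(a, p + nodes S) \<in> spans p S \<Longrightarrow> \<exists>P Q. S = P \<diamondop> Q \<and> Q \<noteq> Leaf \<and> a = p + nodes P"
proof (induction S arbitrary: p)
  case Leaf
  then show ?case by simp
next
  case (Node L R)
  from Node.prems consider "a = p" | "(a, p + nodes L + 1 + nodes R) \<in> spans (p + nodes L + 1) R"
    using spans_bounds[of a "p + nodes (Node L R)" p L] by (auto simp: add.assoc)
  then show ?case
  proof cases
    case 1
    then show ?thesis by (intro exI[of _ Leaf] exI[of _ "Node L R"]) simp
  next
    case 2
    from Node.IH(2)[OF this] obtain P Q where "R = P \<diamondop> Q" "Q \<noteq> Leaf" "a = p + nodes L + 1 + nodes P"
      by blast
    then show ?thesis by (intro exI[of _ "Node L P"] exI[of _ Q]) simp
  qed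
qed

lemma new_intervals_D:
  assumes "(S, T) \<in> new_intervals n"
  shows "nodes S = n" "nodes T = n" "tamari_le S T"
  using assms by (auto simp: new_intervals_iff dest: tamari_le_nodes)

lemma new_intervals_span:
  "(S, T) \<in> new_intervals n \<Longrightarrow> c \<in> spans 0 S \<Longrightarrow> c \<in> spans 0 T \<Longrightarrow> c = (0, n)"
  by (auto simp: new_intervals_iff)

definition inner_spans :: "bintree \<Rightarrow> (nat \<times> nat) set" where
  "inner_spans P = {(a, b) \<in> spans 0 P. b < nodes P}"

text \<open>A comparison \<open>S \<le> T\<close> with a cut \<open>S = P \<diamondop> Q\<close> of the right spine of \<open>S\<close>, such that common
  spans of \<open>S\<close> and \<open>T\<close> can come only from vertices of the right spine of \<open>P\<close>. These are the
  spans that disappear when the cut is lifted: a new vertex with left subtree \<open>Q\<close> is inserted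
  in \<open>S\<close> at the cut and below \<open>T\<close>, which extends the spans of the vertices below the cut.\<close>
definition new_cuts :: "nat \<Rightarrow> (bintree \<times> bintree \<times> bintree) set" where
  "new_cuts n = {(P, Q, T). nodes T = n \<and> tamari_le (P \<diamondop> Q) T \<and>
     spans 0 T \<inter> (inner_spans P \<union> spans (nodes P) Q) = {}}"

definition lift_cut :: "bintree \<times> bintree \<times> bintree \<Rightarrow> interval" where
  "lift_cut = (\<lambda>(P, Q, T). (P \<diamondop> Node Q Leaf, Node T Leaf))"

lemma inj_lift_cut: "inj lift_cut"
proof -
  have aux: "P = P' \<and> Q = Q'"
    if "P \<diamondop> Node Q Leaf = P' \<diamondop> Node Q' Leaf" "nodes P \<le> nodes P'" for P Q P' Q'
  proof -
    from graft_right_split[OF that] obtain X where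
      X: "P' = P \<diamondop> X" "Node Q Leaf = X \<diamondop> Node Q' Leaf" by blast
    then have "X = Leaf" by (cases X) (auto simp: eq_commute[of Leaf "_ \<diamondop> _"])
    with X show ?thesis by simp
  qed
  show ?thesis
  proof (rule injI)
    fix c c' assume "lift_cut c = lift_cut c'"
    then obtain P Q T P' Q' where c: "c = (P, Q, T)" "c' = (P', Q', T)"
      "P \<diamondop> Node Q Leaf = P' \<diamondop> Node Q' Leaf"
      by (cases c; cases c') (auto simp: lift_cut_def)
    then show "c = c'"
      using aux[of P Q P' Q'] aux[of P' Q' P Q] by (cases "nodes P \<le> nodes P'") auto
  qed
qed

text \<open>The right subtree of the bottom vertex of the maximum always matches a subtree of the
  minimum. In a new interval it is trivial, and the bottom vertex corresponds to a
  vertex \<open>Node Q Leaf\<close> on the right spine of the minimum.\<close>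
lemma new_intervals_Suc:
  assumes "n > 0"
  shows "new_intervals (Suc n) = lift_cut ` new_cuts n"
proof (intro set_eqI iffI)
  fix I assume I: "I \<in> new_intervals (Suc n)"
  obtain S T where ST: "I = (S, T)" by force
  have new: "(S, T) \<in> new_intervals (Suc n)" using I ST by simp
  note N = new_intervals_D[OF new] and span = new_intervals_span[OF new]
  obtain U V where T: "T = Node U V" using N(2) by (cases T) auto
  with N(3) obtain P Q R where S: "S = P \<diamondop> Node Q R" and le: "tamari_le (P \<diamondop> Q) U" "tamari_le R V"
    using tamari_le_NodeE by metis
  have nd: "nodes U = nodes P + nodes Q" "nodes R = nodes V"
    using le[THEN tamari_le_nodes] by simp_all
  have V: "V = Leaf"
  proof (rule ccontr)
    assume "V \<noteq> Leaf"
    moreover from this nd have "R \<noteq> Leaf" by force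
    ultimately have "(nodes U + 1, nodes U + 1 + nodes V) \<in> spans (nodes U + 1) V"
      "(nodes U + 1, nodes U + 1 + nodes V) \<in> spans (nodes U + 1) R"
      using root_span[of V "nodes U + 1"] root_span[of R "nodes U + 1"] nd by auto
    then have "(nodes U + 1, nodes U + 1 + nodes V) = (0, Suc n)"
      using nd by (intro span) (auto simp: S T spans_graft_right)
    then show False by simp
  qed
  then have R: "R = Leaf" using nd by auto
  have n: "nodes U = n" using N(2) T V by simp
  have "c \<notin> spans 0 U" if "c \<in> inner_spans P \<union> spans (nodes P) Q" for c
  proof
    assume U: "c \<in> spans 0 U"
    obtain a b where c: "c = (a, b)" by force
    have "c = (0, Suc n)"
      using that U by (intro span) (auto simp: S T c inner_spans_def spans_graft_right)
    with U n show False by (auto dest: spans_bounds)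
  qed
  then have "(P, Q, U) \<in> new_cuts n" using le n by (auto simp: new_cuts_def)
  then show "I \<in> lift_cut ` new_cuts n"
    using ST S T V R by (force simp: lift_cut_def)
next
  fix I assume "I \<in> lift_cut ` new_cuts n"
  then obtain P Q U where M: "(P, Q, U) \<in> new_cuts n" and I: "I = (P \<diamondop> Node Q Leaf, Node U Leaf)"
    by (auto simp: lift_cut_def)
  have U: "nodes U = n" "tamari_le (P \<diamondop> Q) U"
    and sp: "spans 0 U \<inter> (inner_spans P \<union> spans (nodes P) Q) = {}"
    using M by (auto simp: new_cuts_def)
  have nd: "n = nodes P + nodes Q" using U tamari_le_nodes by fastforce
  have "tamari_le (P \<diamondop> Node Q Leaf) (Node U Leaf)"
    using U by (intro tamari_le_raiseI) auto
  moreover have "(a, b) = (0, Suc n)"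
    if "(a, b) \<in> spans 0 (P \<diamondop> Node Q Leaf)" "(a, b) \<in> spans 0 (Node U Leaf)" for a b
  proof (rule ccontr)
    assume "(a, b) \<noteq> (0, Suc n)"
    with that(2) U have ab: "(a, b) \<in> spans 0 U" by auto
    then have "b \<le> n" using spans_bounds U by fastforce
    with that(1) nd have "(a, b) \<in> inner_spans P \<union> spans (nodes P) Q"
      by (auto simp: spans_graft_right inner_spans_def)
    with sp ab show False by blast
  qed
  ultimately show "I \<in> new_intervals (Suc n)"
    unfolding I using U by (auto simp: new_intervals_iff)
qed

definition join_cut :: "interval \<times> bintree \<times> bintree \<times> bintree \<Rightarrow> bintree \<times> bintree \<times> bintree" where
  "join_cut = (\<lambda>((P, U), (Q, R, V)). (P \<diamondop> Q, R, U \<diamondop> V))"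

lemma join_cut_new_cuts:
  assumes "(P, U) \<in> new_intervals a" "(Q, R, V) \<in> new_cuts b"
  shows "(P \<diamondop> Q, R, U \<diamondop> V) \<in> new_cuts (a + b)"
proof -
  note N = new_intervals_D[OF assms(1)]
  have V: "nodes V = b" "tamari_le (Q \<diamondop> R) V"
    and sp: "spans 0 V \<inter> (inner_spans Q \<union> spans (nodes Q) R) = {}"
    using assms(2) by (auto simp: new_cuts_def)
  have b: "b = nodes Q + nodes R" using V tamari_le_nodes by fastforce
  have "tamari_le ((P \<diamondop> Q) \<diamondop> R) (U \<diamondop> V)"
    using N V by (simp add: tamari_le_graft_right_iff)
  moreover have "(x, y) \<notin> inner_spans (P \<diamondop> Q) \<union> spans (nodes (P \<diamondop> Q)) R"
    if T: "(x, y) \<in> spans 0 (U \<diamondop> V)" for x y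
  proof
    assume S: "(x, y) \<in> inner_spans (P \<diamondop> Q) \<union> spans (nodes (P \<diamondop> Q)) R"
    then have xS: "(x, y) \<in> spans 0 P \<and> y < a \<or> (x, y) \<in> spans a Q \<and> y < a + nodes Q \<or>
        (x, y) \<in> spans (a + nodes Q) R"
      using N by (auto simp: inner_spans_def spans_graft_right)
    from T N V have xT: "(x, y) \<in> spans 0 U \<and> y < a \<or> (x, y) \<in> spans a V \<or>
        (x, a) \<in> spans 0 U \<and> y = a + b"
      by (auto simp: spans_graft_right)
    show False
    proof (cases "x < a")
      case True
      with xS have P: "(x, y) \<in> spans 0 P" "y < a" by (auto dest: spans_bounds)
      with xT True have "(x, y) \<in> spans 0 U" by (auto dest: spans_bounds)
      from new_intervals_span[OF assms(1) P(1) this] P show False by simp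
    next
      case False
      then have "(x, y) \<in> spans a V" using xT by (auto dest: spans_bounds)
      moreover have "(x, y) \<in> spans a Q \<and> y < a + nodes Q \<or> (x, y) \<in> spans (a + nodes Q) R"
        using False xS by (auto dest: spans_bounds)
      moreover obtain x' where x: "x = x' + a" using False by (metis le_add_diff_inverse2 not_less)
      moreover obtain y' where y: "y = y' + a"
        using \<open>(x, y) \<in> spans a V\<close> spans_bounds by (metis le_add_diff_inverse2 less_imp_le order_trans)
      ultimately have "(x', y') \<in> spans 0 V"
        "(x', y') \<in> spans 0 Q \<and> y' < nodes Q \<or> (x', y') \<in> spans (nodes Q) R"
        using spans_shift[of x' a y' "nodes Q" R] spans_shift0[of x' a y' V]
          spans_shift0[of x' a y' Q] by (auto simp: add.commute)
      with sp show False by (auto simp: inner_spans_def)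
    qed
  qed
  ultimately show ?thesis using N V by (auto simp: new_cuts_def)
qed

text \<open>All common spans of \<open>P \<diamondop> Q\<close> and \<open>T\<close> reach the last leaf, so they are nested. If only the
  full span is common, the pair is a new interval. Otherwise both trees are cut at the largest
  proper common span: the lower part is a new interval by maximality, and the upper part still
  carries the cut.\<close>
lemma new_cuts_decompose:
  assumes "n > 0"
  shows "new_cuts n = {(P, Q, T). P \<noteq> Leaf \<and> (P \<diamondop> Q, T) \<in> new_intervals n} \<union>
    (\<Union>a\<in>{1..<n}. join_cut ` (new_intervals a \<times> new_cuts (n - a)))" (is "_ = ?A \<union> ?B")
proof (intro set_eqI iffI)
  fix c assume c: "c \<in> new_cuts n"
  obtain P Q T where PQT: "c = (P, Q, T)" by (cases c) auto
  have T: "nodes T = n" "tamari_le (P \<diamondop> Q) T"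
    and sp: "spans 0 T \<inter> (inner_spans P \<union> spans (nodes P) Q) = {}"
    using c PQT by (auto simp: new_cuts_def)
  have n: "n = nodes P + nodes Q" using T tamari_le_nodes by fastforce
  have suffix: "y = n \<and> (x, nodes P) \<in> spans 0 P"
    if "(x, y) \<in> spans 0 (P \<diamondop> Q)" "(x, y) \<in> spans 0 T" for x y
    using that sp n by (auto simp: spans_graft_right inner_spans_def)
  define C where "C = {x. 0 < x \<and> (x, n) \<in> spans 0 (P \<diamondop> Q) \<and> (x, n) \<in> spans 0 T}"
  show "c \<in> ?A \<union> ?B"
  proof (cases "C = {}")
    case True
    have "(x, y) = (0, n)" if "(x, y) \<in> spans 0 (P \<diamondop> Q)" "(x, y) \<in> spans 0 T" for x y
      using suffix[OF that] that True by (auto simp: C_def)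
    then have "(P \<diamondop> Q, T) \<in> new_intervals n"
      using T by (auto simp: new_intervals_iff)
    moreover have "P \<noteq> Leaf"
    proof
      assume "P = Leaf"
      moreover have "T \<noteq> Leaf" "P \<diamondop> Q \<noteq> Leaf" using T n assms by auto
      ultimately have "(0, n) \<in> spans 0 Q" "(0, n) \<in> spans 0 T"
        using root_span[of Q 0] root_span[of T 0] T n by auto
      with sp \<open>P = Leaf\<close> show False by auto
    qed
    ultimately show ?thesis using PQT by simp
  next
    case False
    \<comment> \<open>The smallest first leaf belongs to the largest proper common span.\<close>
    define a where "a = (LEAST x. x \<in> C)"
    have a: "a \<in> C" and least: "\<And>x. x \<in> C \<Longrightarrow> a \<le> x"
      unfolding a_def using False by (auto intro: LeastI Least_le)
    then have a0: "0 < a" and aS: "(a, n) \<in> spans 0 (P \<diamondop> Q)" and aT: "(a, n) \<in> spans 0 T"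
      by (auto simp: C_def)
    from suffix[OF aS aT] suffix_span_cut[of a 0 P] obtain P1 P2 where
      P: "P = P1 \<diamondop> P2" "P2 \<noteq> Leaf" "a = nodes P1" by auto
    from aT T suffix_span_cut[of a 0 T] obtain U V where
      T': "T = U \<diamondop> V" "V \<noteq> Leaf" "a = nodes U" by auto
    have le: "tamari_le P1 U" "tamari_le (P2 \<diamondop> Q) V"
      using T(2) P T' by (auto simp: tamari_le_graft_right_iff)
    have an: "a < n" using aT spans_bounds by blast
    have "(P1, U) \<in> new_intervals a"
    proof -
      have "(x, y) = (0, a)" if x: "(x, y) \<in> spans 0 P1" "(x, y) \<in> spans 0 U" for x y
      proof -
        have b: "x < y" "y \<le> a" using spans_bounds[OF x(1)] P by auto
        have "y = a"
        proof (rule ccontr)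
          assume "y \<noteq> a"
          with x b P T' have "(x, y) \<in> spans 0 (P \<diamondop> Q)" "(x, y) \<in> spans 0 T"
            by (auto simp: spans_graft_right)
          from suffix[OF this] b an show False by simp
        qed
        with x P T' have xn: "(x, n) \<in> spans 0 (P \<diamondop> Q)" "(x, n) \<in> spans 0 T"
          using n T by (auto simp: spans_graft_right)
        have "x = 0"
        proof (rule ccontr)
          assume "x \<noteq> 0"
          with xn have "x \<in> C" by (auto simp: C_def)
          from least[OF this] b show False by simp
        qed
        with \<open>y = a\<close> show ?thesis by simp
      qed
      then show ?thesis using le T' by (auto simp: new_intervals_iff)
    qed
    moreover have "(P2, Q, V) \<in> new_cuts (n - a)"
    proof -
      have "(x, y) \<notin> inner_spans P2 \<union> spans (nodes P2) Q" if "(x, y) \<in> spans 0 V" for x y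
      proof
        assume "(x, y) \<in> inner_spans P2 \<union> spans (nodes P2) Q"
        then have "(x, y) \<in> spans 0 P2 \<and> y < nodes P2 \<or> (x, y) \<in> spans (nodes P2) Q"
          by (auto simp: inner_spans_def)
        then have "(x + a, y + a) \<in> inner_spans P \<union> spans (nodes P) Q"
          using spans_shift[of x a y "nodes P2" Q] spans_shift0[of x a y P2] P
          by (auto simp: inner_spans_def spans_graft_right add.commute)
        moreover have "(x + a, y + a) \<in> spans 0 T"
          using that T' spans_shift0[of x a y V] by (auto simp: spans_graft_right)
        ultimately show False using sp by blast
      qed
      then show ?thesis using le T T' by (auto simp: new_cuts_def)
    qed
    ultimately have "c \<in> join_cut ` (new_intervals a \<times> new_cuts (n - a))"
      using PQT P T' by (force simp: join_cut_def)
    with a0 an show ?thesis by auto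
  qed
next
  fix c assume "c \<in> ?A \<union> ?B"
  then show "c \<in> new_cuts n"
  proof
    assume "c \<in> ?A"
    then obtain P Q T where c: "c = (P, Q, T)" "P \<noteq> Leaf" "(P \<diamondop> Q, T) \<in> new_intervals n" by auto
    note N = new_intervals_D[OF c(3)]
    have "(x, y) \<notin> spans 0 T" if S: "(x, y) \<in> inner_spans P \<union> spans (nodes P) Q" for x y
    proof
      assume T: "(x, y) \<in> spans 0 T"
      from S have "(x, y) \<in> spans 0 (P \<diamondop> Q)" by (auto simp: inner_spans_def spans_graft_right)
      from new_intervals_span[OF c(3) this T] have "x = 0" "y = n" by auto
      moreover have "nodes P > 0" using c(2) by (cases P) auto
      ultimately show False using S N(1) by (auto simp: inner_spans_def dest: spans_bounds)
    qed
    then show ?thesis using N c by (auto simp: new_cuts_def)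
  next
    assume "c \<in> ?B"
    then obtain a P U Q R V where "a \<in> {1..<n}" "(P, U) \<in> new_intervals a"
      "(Q, R, V) \<in> new_cuts (n - a)" "c = (P \<diamondop> Q, R, U \<diamondop> V)"
      by (auto simp: join_cut_def)
    with join_cut_new_cuts[of P U a Q R V "n - a"] show ?thesis by simp
  qed
qed

text \<open>If the lower parts had different sizes, the larger one would contain a common span
  starting where the smaller one ends, and would not be new.\<close>
lemma join_cut_inject:
  assumes "(P, U) \<in> new_intervals a" "(P', U') \<in> new_intervals a'"
    and "P \<diamondop> Q = P' \<diamondop> Q'" "U \<diamondop> V = U' \<diamondop> V'" "0 < a" "0 < a'"
  shows "a = a' \<and> P = P' \<and> U = U' \<and> Q = Q' \<and> V = V'"
proof -
  have aux: False
    if 1: "(P, U) \<in> new_intervals a" "(P', U') \<in> new_intervals a'"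
      "P \<diamondop> Q = P' \<diamondop> Q'" "U \<diamondop> V = U' \<diamondop> V'" "0 < a" and "a < a'"
    for P U a P' U' a' Q Q' V V'
  proof -
    note N = new_intervals_D[OF 1(1)] and N' = new_intervals_D[OF 1(2)]
    from graft_right_split[OF 1(3)] N N' that(6) obtain X where X: "P' = P \<diamondop> X" by auto
    from graft_right_split[OF 1(4)] N N' that(6) obtain Y where Y: "U' = U \<diamondop> Y" by auto
    have "X \<noteq> Leaf" "Y \<noteq> Leaf" "a + nodes X = a'" "a + nodes Y = a'" using X Y N N' that(6) by auto
    then have "(a, a') \<in> spans 0 P'" "(a, a') \<in> spans 0 U'"
      using root_span[of X a] root_span[of Y a] N X Y by (auto simp: spans_graft_right)
    from new_intervals_span[OF 1(2) this] that(5) show False by simp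
  qed
  have "a = a'"
    using aux[OF assms(1,2,3,4,5)] aux[OF assms(2,1) assms(3)[symmetric] assms(4)[symmetric] assms(6)]
    by (meson linorder_neqE_nat)
  with assms show ?thesis
    using graft_right_inject[of P Q P' Q'] graft_right_inject[of U V U' V']
      new_intervals_D[OF assms(1)] new_intervals_D[OF assms(2)] by auto
qed

lemma join_cut_not_new:
  assumes "(P, U) \<in> new_intervals a" "(Q, R, V) \<in> new_cuts b" "0 < a" "0 < b"
  shows "(P \<diamondop> Q \<diamondop> R, U \<diamondop> V) \<notin> new_intervals n"
proof
  assume n: "(P \<diamondop> Q \<diamondop> R, U \<diamondop> V) \<in> new_intervals n"
  note N = new_intervals_D[OF assms(1)]
  have V: "nodes V = b" "tamari_le (Q \<diamondop> R) V" using assms(2) by (auto simp: new_cuts_def)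
  then have "V \<noteq> Leaf" "nodes (Q \<diamondop> R) = b" "Q \<diamondop> R \<noteq> Leaf"
    using assms(4) tamari_le_nodes[OF V(2)] by fastforce+
  then have "(a, a + b) \<in> spans 0 (P \<diamondop> Q \<diamondop> R)" "(a, a + b) \<in> spans 0 (U \<diamondop> V)"
    using root_span[of V a] root_span[of "Q \<diamondop> R" a] N V by (auto simp: spans_graft_right)
  from new_intervals_span[OF n this] assms(3) show False by simp
qed

lemma finite_new_intervals: "finite (new_intervals n)"
proof -
  have Y: "finite {T. nodes T \<le> m}" for m
  proof (induction m)
    case 0
    have "{T. nodes T \<le> 0} = {Leaf}" by auto
    then show ?case by simp
  next
    case (Suc m)
    have "{T. nodes T \<le> Suc m} \<subseteq>
        insert Leaf ((\<lambda>(L, R). Node L R) ` ({T. nodes T \<le> m} \<times> {T. nodes T \<le> m}))"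
    proof
      fix T assume "T \<in> {T. nodes T \<le> Suc m}"
      then show "T \<in> insert Leaf ((\<lambda>(L, R). Node L R) ` ({T. nodes T \<le> m} \<times> {T. nodes T \<le> m}))"
        by (cases T) auto
    qed
    then show ?case by (rule finite_subset) (use Suc in auto)
  qed
  have "new_intervals n \<subseteq> {T. nodes T \<le> n} \<times> {T. nodes T \<le> n}"
    using new_intervals_D by fastforce
  then show ?thesis by (rule finite_subset) (use Y in auto)
qed

lemma finite_new_cuts: "n > 0 \<Longrightarrow> finite (new_cuts n)"
  using finite_new_intervals[of "Suc n"] inj_lift_cut
  by (auto simp: new_intervals_Suc finite_image_iff inj_on_subset)


section \<open>The functional equation with a catalytic variable\<close>

fun nonempty_cuts :: "bintree \<Rightarrow> (bintree \<times> bintree) set" where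
  "nonempty_cuts Leaf = {}"
| "nonempty_cuts (Node L R) = (\<lambda>(P, Q). (Node L P, Q)) ` insert (Leaf, R) (nonempty_cuts R)"

lemma mem_nonempty_cuts: "(P, Q) \<in> nonempty_cuts S \<longleftrightarrow> P \<noteq> Leaf \<and> P \<diamondop> Q = S"
proof (induction S arbitrary: P)
  case Leaf
  show ?case by auto
next
  case (Node L R)
  show ?case
  proof (cases P)
    case Leaf
    then show ?thesis by auto
  next
    case P: (Node A B)
    show ?thesis using Node.IH(2)[of B] P by (cases "B = Leaf") force+
  qed
qed

lemma finite_nonempty_cuts: "finite (nonempty_cuts S)"
  by (induction S) auto

lemma sum_nonempty_cuts:
  fixes x :: "'a :: comm_ring_1"
  shows "(x - 1) * (\<Sum>(P, Q)\<in>nonempty_cuts S. x ^ right_spine P) = x * (x ^ right_spine S - 1)"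
proof (induction S)
  case Leaf
  show ?case by simp
next
  case (Node L R)
  have "(\<Sum>(P, Q)\<in>nonempty_cuts (Node L R). x ^ right_spine P) =
      (\<Sum>(P, Q)\<in>insert (Leaf, R) (nonempty_cuts R). x ^ Suc (right_spine P))"
    by (simp only: nonempty_cuts.simps, subst sum.reindex)
      (auto simp: inj_on_def intro!: sum.cong)
  also have "\<dots> = x * (1 + (\<Sum>(P, Q)\<in>nonempty_cuts R. x ^ right_spine P))"
    by (subst sum.insert)
      (auto simp: finite_nonempty_cuts mem_nonempty_cuts sum_distrib_left ring_distribs case_prod_unfold)
  finally have "(x - 1) * (\<Sum>(P, Q)\<in>nonempty_cuts (Node L R). x ^ right_spine P) =
      x * ((x - 1) + (x - 1) * (\<Sum>(P, Q)\<in>nonempty_cuts R. x ^ right_spine P))"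
    by (simp add: algebra_simps)
  then show ?case unfolding Node.IH(2) by (simp add: algebra_simps)
qed

text \<open>The series variable marks the number of internal vertices, and \<open>x\<close> marks the length of the
  right spine of the minimum. The catalytic variable \<open>x\<close> is a real parameter instead of a second
  indeterminate, so that the value at \<open>x = 1\<close> can be reached by continuity of the coefficients.
  The constant coefficient is set to zero, which leaves out the trivial tree.\<close>
definition new_fps :: "real \<Rightarrow> real fps" where
  "new_fps x = Abs_fps (\<lambda>n. if n = 0 then 0 else \<Sum>(S, T)\<in>new_intervals n. x ^ right_spine S)"

definition cut_fps :: "real \<Rightarrow> real fps" where
  "cut_fps x = Abs_fps (\<lambda>n. if n = 0 then 0 else \<Sum>(P, Q, T)\<in>new_cuts n. x ^ Suc (right_spine P))"

lemma new_intervals_1: "new_intervals (Suc 0) = {(Node Leaf Leaf, Node Leaf Leaf)}"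
proof (intro set_eqI iffI)
  fix I assume "I \<in> new_intervals (Suc 0)"
  then obtain S T where I: "I = (S, T)" "(S, T) \<in> new_intervals (Suc 0)" by (cases I) auto
  from new_intervals_D(1,2)[OF I(2)] I(1) show "I \<in> {(Node Leaf Leaf, Node Leaf Leaf)}"
    by (cases S; cases T) auto
qed (auto simp: new_intervals_iff)

lemma new_fps_eq_cut_fps: "new_fps x = fps_const x * fps_X + fps_X * cut_fps x"
proof (rule fps_ext)
  fix n
  consider "n = 0" | "n = 1" | m where "n = Suc m" "m > 0" by (cases n) force+
  then show "fps_nth (new_fps x) n = fps_nth (fps_const x * fps_X + fps_X * cut_fps x) n"
  proof cases
    case 3
    have "(\<Sum>(S, T)\<in>new_intervals (Suc m). x ^ right_spine S) =
        (\<Sum>(P, Q, T)\<in>new_cuts m. x ^ Suc (right_spine P))"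
      unfolding new_intervals_Suc[OF 3(2)] sum.reindex[OF inj_on_subset[OF inj_lift_cut subset_UNIV]]
      by (auto simp: lift_cut_def intro!: sum.cong)
    with 3 show ?thesis by (simp add: new_fps_def cut_fps_def)
  qed (simp_all add: new_fps_def cut_fps_def new_intervals_1)
qed

text \<open>The decomposition of cuts, weighted by \<open>x\<close> to the length of the right spine after lifting;
  right spines add up under \<open>\<diamondop>\<close>.\<close>
lemma sum_new_cuts:
  assumes "n > 0"
  shows "(\<Sum>(P, Q, T)\<in>new_cuts n. x ^ Suc (right_spine P)) =
    (\<Sum>(S, T)\<in>new_intervals n. x * (\<Sum>(P, Q)\<in>nonempty_cuts S. x ^ right_spine P)) +
    (\<Sum>a\<in>{1..<n}. (\<Sum>(S, T)\<in>new_intervals a. x ^ right_spine S) *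
      (\<Sum>(P, Q, T)\<in>new_cuts (n - a). (x::real) ^ Suc (right_spine P)))"
proof -
  let ?w = "\<lambda>(P, Q, T). x ^ Suc (right_spine P) :: real"
  let ?A = "{(P, Q, T). P \<noteq> Leaf \<and> (P \<diamondop> Q, T) \<in> new_intervals n}"
  let ?D = "\<lambda>a. new_intervals a \<times> new_cuts (n - a)"
  let ?B = "\<Union>a\<in>{1..<n}. join_cut ` ?D a"
  have M: "new_cuts n = ?A \<union> ?B" by (rule new_cuts_decompose[OF assms])
  have fin: "finite ?A" "finite ?B"
    using finite_new_cuts[OF assms] unfolding M by simp_all
  have disj: "?A \<inter> ?B = {}"
  proof -
    have False if "c \<in> ?A" "c \<in> ?B" for c
    proof -
      from that obtain a P U Q R V where "a \<in> {1..<n}" "(P, U) \<in> new_intervals a"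
        "(Q, R, V) \<in> new_cuts (n - a)" "c = (P \<diamondop> Q, R, U \<diamondop> V)"
        by (auto simp: join_cut_def)
      with join_cut_not_new[of P U a Q R V "n - a" n] that(1) show False by simp
    qed
    then show ?thesis by blast
  qed
  have inj: "p = p'" "a = a'"
    if "p \<in> ?D a" "p' \<in> ?D a'" "join_cut p = join_cut p'" "0 < a" "0 < a'" for p p' a a'
  proof -
    obtain P U Q R V where p: "p = ((P, U), (Q, R, V))" by (metis surj_pair)
    obtain P' U' Q' R' V' where p': "p' = ((P', U'), (Q', R', V'))" by (metis surj_pair)
    from that show "p = p'" "a = a'"
      unfolding p p' using join_cut_inject[of P U a P' U' a' Q Q' V V'] by (auto simp: join_cut_def)
  qed
  have "sum ?w (new_cuts n) = sum ?w ?A + sum ?w ?B"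
    unfolding M by (rule sum.union_disjoint[OF fin disj])
  also have "sum ?w ?A = (\<Sum>(S, T)\<in>new_intervals n. x * (\<Sum>(P, Q)\<in>nonempty_cuts S. x ^ right_spine P))"
  proof -
    have "sum ?w ?A = (\<Sum>(I, c)\<in>Sigma (new_intervals n) (\<lambda>I. nonempty_cuts (fst I)).
        x ^ Suc (right_spine (fst c)))"
      by (rule sum.reindex_bij_witness[where j = "\<lambda>(P, Q, T). ((P \<diamondop> Q, T), (P, Q))"
            and i = "\<lambda>((S, T), (P, Q)). (P, Q, T)"])
        (auto simp: mem_nonempty_cuts)
    also have "\<dots> = (\<Sum>I\<in>new_intervals n. \<Sum>c\<in>nonempty_cuts (fst I). x ^ Suc (right_spine (fst c)))"
      by (rule sum.Sigma[symmetric]) (auto simp: finite_new_intervals finite_nonempty_cuts)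
    finally show ?thesis by (simp add: sum_distrib_left case_prod_unfold)
  qed
  also have "sum ?w ?B = (\<Sum>a\<in>{1..<n}. sum ?w (join_cut ` ?D a))"
  proof (rule sum.UNION_disjoint)
    show "\<forall>a\<in>{1..<n}. finite (join_cut ` ?D a)"
      using finite_new_cuts finite_new_intervals by auto
    show "\<forall>a\<in>{1..<n}. \<forall>b\<in>{1..<n}. a \<noteq> b \<longrightarrow> join_cut ` ?D a \<inter> join_cut ` ?D b = {}"
    proof (intro ballI impI)
      fix a b assume ab: "a \<in> {1..<n}" "b \<in> {1..<n}" "a \<noteq> b"
      show "join_cut ` ?D a \<inter> join_cut ` ?D b = {}"
      proof (rule ccontr)
        assume "join_cut ` ?D a \<inter> join_cut ` ?D b \<noteq> {}"
        then obtain p p' where "p \<in> ?D a" "p' \<in> ?D b" "join_cut p = join_cut p'" by blast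
        from inj(2)[OF this] ab show False by simp
      qed
    qed
  qed simp
  also have "\<dots> = (\<Sum>a\<in>{1..<n}. (\<Sum>(S, T)\<in>new_intervals a. x ^ right_spine S) *
      sum ?w (new_cuts (n - a)))"
  proof (rule sum.cong[OF refl])
    fix a assume a: "a \<in> {1..<n}"
    have "inj_on join_cut (?D a)"
      by (rule inj_onI) (use inj(1)[of _ a _ a] a in auto)
    then have "sum ?w (join_cut ` ?D a) = sum (?w \<circ> join_cut) (?D a)"
      by (rule sum.reindex)
    also have "\<dots> = (\<Sum>(I, c)\<in>?D a. x ^ right_spine (fst I) * ?w c)"
      by (rule sum.cong) (auto simp: join_cut_def power_add algebra_simps)
    also have "\<dots> = (\<Sum>I\<in>new_intervals a. \<Sum>c\<in>new_cuts (n - a). x ^ right_spine (fst I) * ?w c)"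
      by (rule sum.cartesian_product[symmetric])
    finally show "sum ?w (join_cut ` ?D a) =
        (\<Sum>(S, T)\<in>new_intervals a. x ^ right_spine S) * sum ?w (new_cuts (n - a))"
      by (simp add: sum_product case_prod_unfold)
  qed
  finally show ?thesis .
qed

text \<open>By \<open>sum_new_cuts\<close>, a cut is a sequence of new intervals followed by a new interval that is
  cut somewhere above its bottom vertex; the factor \<open>x - 1\<close> sums the geometric series over the
  places of that last cut.\<close>
lemma cut_fps_eq:
  "fps_const (x - 1) * cut_fps x * (1 - new_fps x) = fps_const (x\<^sup>2) * (new_fps x - new_fps 1)"
proof -
  have "fps_const (x - 1) * cut_fps x =
      fps_const (x\<^sup>2) * (new_fps x - new_fps 1) + new_fps x * (fps_const (x - 1) * cut_fps x)"
  proof (rule fps_ext)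
    fix n
    show "fps_nth (fps_const (x - 1) * cut_fps x) n =
      fps_nth (fps_const (x\<^sup>2) * (new_fps x - new_fps 1) + new_fps x * (fps_const (x - 1) * cut_fps x)) n"
    proof (cases "n = 0")
      case True
      then show ?thesis by (simp add: cut_fps_def new_fps_def)
    next
      case False
      let ?N = "\<lambda>a. \<Sum>(S, T)\<in>new_intervals a. x ^ right_spine S"
      let ?C = "\<lambda>a. \<Sum>(P, Q, T)\<in>new_cuts a. x ^ Suc (right_spine P)"
      have "(x - 1) * (\<Sum>(S, T)\<in>new_intervals n. x * (\<Sum>(P, Q)\<in>nonempty_cuts S. x ^ right_spine P))
          = (\<Sum>(S, T)\<in>new_intervals n. x * ((x - 1) * (\<Sum>(P, Q)\<in>nonempty_cuts S. x ^ right_spine P)))"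
        by (simp add: sum_distrib_left case_prod_unfold algebra_simps)
      also have "\<dots> = (\<Sum>(S, T)\<in>new_intervals n. x\<^sup>2 * (x ^ right_spine S - 1 ^ right_spine S))"
        by (simp add: sum_nonempty_cuts power2_eq_square mult.assoc)
      also have "\<dots> = x\<^sup>2 * fps_nth (new_fps x - new_fps 1) n"
        using False by (simp add: new_fps_def case_prod_unfold sum_distrib_left[symmetric] sum_subtractf)
      finally have 1: "(x - 1) * (\<Sum>(S, T)\<in>new_intervals n. x * (\<Sum>(P, Q)\<in>nonempty_cuts S. x ^ right_spine P))
          = x\<^sup>2 * fps_nth (new_fps x - new_fps 1) n" .
      have "fps_nth (new_fps x * (fps_const (x - 1) * cut_fps x)) n =
          (\<Sum>a\<in>{0..n}. (x - 1) * (fps_nth (new_fps x) a * fps_nth (cut_fps x) (n - a)))"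
        by (subst mult.left_commute, subst fps_mult_left_const_nth)
          (simp only: fps_mult_nth sum_distrib_left)
      also have "\<dots> = (\<Sum>a\<in>{1..<n}. (x - 1) * (fps_nth (new_fps x) a * fps_nth (cut_fps x) (n - a)))"
        by (rule sum.mono_neutral_right) (auto simp: new_fps_def cut_fps_def not_less_eq)
      also have "\<dots> = (\<Sum>a\<in>{1..<n}. (x - 1) * (?N a * ?C (n - a)))"
        by (rule sum.cong) (auto simp: new_fps_def cut_fps_def)
      also have "\<dots> = (x - 1) * (\<Sum>a\<in>{1..<n}. ?N a * ?C (n - a))"
        by (rule sum_distrib_left[symmetric])
      finally have 2: "fps_nth (new_fps x * (fps_const (x - 1) * cut_fps x)) n =
        (x - 1) * (\<Sum>a\<in>{1..<n}. ?N a * ?C (n - a))" .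
      have "fps_nth (fps_const (x - 1) * cut_fps x) n = (x - 1) * ?C n"
        using False by (simp add: cut_fps_def)
      also have "\<dots> = x\<^sup>2 * fps_nth (new_fps x - new_fps 1) n +
          fps_nth (new_fps x * (fps_const (x - 1) * cut_fps x)) n"
        using False unfolding 2 1[symmetric] by (subst sum_new_cuts) (simp_all add: distrib_left)
      finally show ?thesis by simp
    qed
  qed
  then show ?thesis by (simp add: algebra_simps)
qed

definition solves_catalytic_equation :: "(real \<Rightarrow> real fps) \<Rightarrow> bool" where
  "solves_catalytic_equation F \<longleftrightarrow> (\<forall>x. fps_nth (F x) 0 = 0 \<and>
     fps_const (x - 1) * (F x - fps_const x * fps_X) * (1 - F x) =
     fps_X * fps_const (x\<^sup>2) * (F x - F 1)) \<and> (\<forall>n. isCont (\<lambda>x. fps_nth (F x) n) 1)"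

lemma new_fps_solves: "solves_catalytic_equation new_fps"
  unfolding solves_catalytic_equation_def
proof (intro conjI allI)
  fix x
  show "fps_nth (new_fps x) 0 = 0" by (simp add: new_fps_def)
  have "new_fps x - fps_const x * fps_X = fps_X * cut_fps x"
    by (simp add: new_fps_eq_cut_fps)
  then have "fps_const (x - 1) * (new_fps x - fps_const x * fps_X) * (1 - new_fps x) =
      fps_X * (fps_const (x - 1) * cut_fps x * (1 - new_fps x))"
    by (simp only: ac_simps)
  then show "fps_const (x - 1) * (new_fps x - fps_const x * fps_X) * (1 - new_fps x) =
     fps_X * fps_const (x\<^sup>2) * (new_fps x - new_fps 1)"
    unfolding cut_fps_eq by (simp only: mult.assoc)
next
  fix n
  show "isCont (\<lambda>x. fps_nth (new_fps x) n) 1"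
    by (cases "n = 0") (auto simp: new_fps_def case_prod_unfold intro!: continuous_intros)
qed

text \<open>The equation determines the coefficient of index \<open>n\<close> from the earlier ones wherever
  \<open>x - 1\<close> can be cancelled, and continuity supplies the value at \<open>x = 1\<close> that the next step
  needs.\<close>
lemma catalytic_equation_unique:
  assumes "solves_catalytic_equation F" "solves_catalytic_equation H"
  shows "F x = H x"
proof -
  have eqs: "fps_const (x - 1) * F x = fps_const (x - 1) * (fps_const x * fps_X + (F x - fps_const x * fps_X) * F x)
      + fps_X * (fps_const (x\<^sup>2) * (F x - F 1))" if "solves_catalytic_equation F" for F x
  proof -
    have "fps_const (x - 1) * (F x - fps_const x * fps_X) * (1 - F x) =
     fps_X * fps_const (x\<^sup>2) * (F x - F 1)"
      using that unfolding solves_catalytic_equation_def by blast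
    then show ?thesis by algebra
  qed
  have "\<forall>x. fps_nth (F x) n = fps_nth (H x) n" for n
  proof (induction n rule: less_induct)
    case (less n)
    have zero: "fps_nth (F x) 0 = 0" "fps_nth (H x) 0 = 0" for x
      using assms unfolding solves_catalytic_equation_def by blast+
    have ne1: "fps_nth (F x) n = fps_nth (H x) n" if "x \<noteq> 1" for x
    proof -
      have "fps_nth ((F x - fps_const x * fps_X) * F x) n = fps_nth ((H x - fps_const x * fps_X) * H x) n"
        unfolding fps_mult_nth
      proof (rule sum.cong[OF refl])
        fix i assume i: "i \<in> {0..n}"
        consider "i = 0" | "i = n" | "0 < i" "i < n" using i by force
        then show "fps_nth (F x - fps_const x * fps_X) i * fps_nth (F x) (n - i) =
          fps_nth (H x - fps_const x * fps_X) i * fps_nth (H x) (n - i)"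
          using zero less by cases auto
      qed
      moreover have "fps_nth (fps_X * (fps_const (x\<^sup>2) * (F x - F 1))) n =
          fps_nth (fps_X * (fps_const (x\<^sup>2) * (H x - H 1))) n"
        using less by (cases n) auto
      ultimately have "fps_nth (fps_const (x - 1) * F x) n = fps_nth (fps_const (x - 1) * H x) n"
        unfolding eqs[OF assms(1)] eqs[OF assms(2)] by simp
      then show ?thesis using that by simp
    qed
    have "fps_nth (F 1) n = fps_nth (H 1) n"
    proof (rule tendsto_unique)
      show "((\<lambda>x. fps_nth (F x) n) \<longlongrightarrow> fps_nth (F 1) n) (at 1)"
        using assms(1) unfolding solves_catalytic_equation_def isCont_def by blast
      have "((\<lambda>x. fps_nth (H x) n) \<longlongrightarrow> fps_nth (H 1) n) (at 1)"
        using assms(2) unfolding solves_catalytic_equation_def isCont_def by blast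
      then show "((\<lambda>x. fps_nth (F x) n) \<longlongrightarrow> fps_nth (H 1) n) (at 1)"
        by (rule Lim_transform_eventually) (auto simp: eventually_at_filter ne1)
    qed simp
    then show ?case using ne1 by metis
  qed
  then show ?thesis by (simp add: fps_eq_iff)
qed


section \<open>Solution of the functional equation\<close>

text \<open>This is \<open>(1 - sqrt (1 - 4 t)) / 2\<close>, the solution \<open>c\<close> of \<open>c = t + c\<^sup>2\<close> without constant
  term; its coefficients are the Catalan numbers.\<close>
definition catalan_fps :: "real fps" where
  "catalan_fps = fps_const (1/2) * (1 - (fps_binomial (1/2) oo (fps_const (-4) * fps_X)))"

lemma catalan_fps_0 [simp]: "fps_nth catalan_fps 0 = 0"
  by (simp add: catalan_fps_def fps_compose_linear)

lemma catalan_fps_nth: "fps_nth catalan_fps (Suc n) = fact (2 * n) / (fact n * fact (Suc n))"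
proof -
  have "(-4) ^ Suc n * ((1/2 :: real) gchoose Suc n) = - 2 * fact (2 * n) / (fact n * fact (Suc n))"
  proof (induction n)
    case 0
    show ?case by simp
  next
    case (Suc n)
    have rec: "((1/2 :: real) gchoose Suc (Suc n)) = (1/2 gchoose Suc n) * (1/2 - real (Suc n)) / real (Suc (Suc n))"
      by (simp add: gbinomial_prod_rev atLeast0_lessThan_Suc ac_simps)
    have "(-4) ^ Suc (Suc n) * ((1/2 :: real) gchoose Suc (Suc n)) =
        ((-4) ^ Suc n * (1/2 gchoose Suc n)) * (4 * real n + 2) / real (Suc (Suc n))"
      unfolding rec by (simp add: field_simps)
    also have "\<dots> = - 2 * fact (2 * n) / (fact n * fact (Suc n)) * (4 * real n + 2) / real (Suc (Suc n))"
      unfolding Suc ..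
    also have "\<dots> = - 2 * fact (2 * Suc n) / (fact (Suc n) * fact (Suc (Suc n)))"
      by (simp add: divide_simps) (simp add: algebra_simps)
    finally show ?case .
  qed
  then show ?thesis by (simp add: catalan_fps_def fps_compose_linear)
qed

lemma catalan_fps_eq: "catalan_fps = fps_X + catalan_fps\<^sup>2"
proof -
  define b where "b = (fps_binomial (1/2) oo (fps_const (-4::real) * fps_X))"
  have "b * b = (fps_binomial (1/2) * fps_binomial (1/2)) oo (fps_const (-4) * fps_X)"
    unfolding b_def by (rule fps_compose_mult_distrib[symmetric]) simp
  also have "fps_binomial (1/2) * fps_binomial (1/2) = (1 + fps_X :: real fps)"
    by (simp flip: fps_binomial_add_mult add: fps_binomial_1)
  also have "((1 + fps_X) oo (fps_const (-4) * fps_X)) = (1 - 4 * fps_X :: real fps)"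
    by (simp add: fps_compose_add_distrib numeral_fps_const flip: fps_const_neg)
  finally have b: "b * b = 1 - 4 * fps_X" .
  have h: "fps_const (1/2) * 2 = (1 :: real fps)" by (simp add: numeral_fps_const)
  have "catalan_fps = fps_const (1/2) * (1 - b)" by (simp add: catalan_fps_def b_def)
  with b h show ?thesis by algebra
qed

lemma catalan_fps_compose:
  assumes "fps_nth w 0 = 0"
  shows "(catalan_fps oo w) = w + (catalan_fps oo w)\<^sup>2"
proof -
  have "(catalan_fps oo w) = ((fps_X + catalan_fps\<^sup>2) oo w)"
    using catalan_fps_eq by (rule arg_cong)
  also have "\<dots> = w + (catalan_fps oo w)\<^sup>2"
    using assms by (simp add: fps_compose_add_distrib fps_compose_power)
  finally show ?thesis .
qed

text \<open>The solution is found by the quadratic method. With \<open>N = new_fps x\<close>, the functional equation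
  is quadratic in \<open>N\<close>, with discriminant
  \<open>(1 - (1 - t) x)\<^sup>2 - 4 t x (x - 1)\<^sup>2 + 4 t (x - 1) x\<^sup>2 N\<^sub>1\<close>, where \<open>N\<^sub>1\<close> is the value of \<open>N\<close> at
  \<open>x = 1\<close>. Requiring this cubic polynomial in \<open>x\<close> to have a double root forces
  it to be \<open>(1 - (1 - s) x)\<^sup>2 (1 - 4 s (1 - s) x)\<close> with \<open>t = s - 2 s\<^sup>2\<close>. The series \<open>u\<close> below
  rationalises the remaining square root, which is \<open>1 - 2 u\<close>, and \<open>solution\<close> is the root
  of the quadratic equation in terms of \<open>s\<close> and \<open>u\<close>, after cancelling \<open>u - s\<close>.\<close>
definition s_fps :: "real fps" where
  "s_fps = fps_const (1/2) * (catalan_fps oo (fps_const 2 * fps_X))"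

definition u_fps :: "real \<Rightarrow> real fps" where
  "u_fps x = (catalan_fps oo (fps_const x * (s_fps * (1 - s_fps))))"

definition solution :: "real \<Rightarrow> real fps" where
  "solution x = u_fps x * (1 - 2 * s_fps - (1 - s_fps) * u_fps x) * inverse (1 - u_fps x - s_fps)"

lemma s_fps_0 [simp]: "fps_nth s_fps 0 = 0"
  by (simp add: s_fps_def fps_compose_linear)

lemma s_fps_nth: "fps_nth s_fps (Suc n) = 2 ^ n * fact (2 * n) / (fact n * fact (Suc n))"
  by (simp add: s_fps_def fps_compose_linear catalan_fps_nth del: fact_Suc)

lemma s_fps_eq: "s_fps = fps_X + 2 * s_fps\<^sup>2"
proof -
  have h: "fps_const (1/2) * 2 = (1 :: real fps)" "fps_const 2 = (2 :: real fps)"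
    by (simp_all add: numeral_fps_const)
  have "(catalan_fps oo (fps_const 2 * fps_X)) = fps_const 2 * fps_X + (catalan_fps oo (fps_const 2 * fps_X))\<^sup>2"
    by (rule catalan_fps_compose) simp
  with h show ?thesis unfolding s_fps_def by algebra
qed

lemma u_fps_0 [simp]: "fps_nth (u_fps x) 0 = 0"
  by (simp add: u_fps_def fps_compose_nth)

lemma u_fps_eq: "u_fps x = fps_const x * (s_fps * (1 - s_fps)) + (u_fps x)\<^sup>2"
  unfolding u_fps_def by (rule catalan_fps_compose) simp

lemma u_fps_at_1: "u_fps 1 = s_fps"
proof -
  have "(u_fps 1 - s_fps) * (1 - u_fps 1 - s_fps) = 0"
    using u_fps_eq[of 1] by (simp only: fps_const_1_eq_1) algebra
  moreover have "fps_nth (1 - u_fps 1 - s_fps) 0 \<noteq> 0" by simp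
  then have "1 - u_fps 1 - s_fps \<noteq> 0" by (metis fps_zero_nth)
  ultimately show ?thesis by simp
qed

lemma solution_mult:
  "solution x * (1 - u_fps x - s_fps) = u_fps x * (1 - 2 * s_fps - (1 - s_fps) * u_fps x)"
  by (simp add: solution_def mult.assoc inverse_mult_eq_1)

lemma solution_at_1: "solution 1 * (1 - 2 * s_fps) = s_fps * (1 - 3 * s_fps + s_fps\<^sup>2)"
  using solution_mult[of 1] unfolding u_fps_at_1 by algebra

text \<open>As rational functions of \<open>s\<close> and \<open>u\<close>, each of \<open>x - 1\<close>, \<open>N - x t\<close>, \<open>1 - N\<close> and \<open>N - N1\<close> splits
  into small factors, with denominators made of \<open>k = s (1 - s)\<close>, \<open>1 - s\<close>, \<open>1 - 2 s\<close> and
  \<open>d = 1 - u - s\<close>. After multiplication by \<open>k (1 - s) d\<^sup>2\<close> the factors on both sides agree.\<close>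
lemma catalytic_identity:
  fixes x t s u N N1 :: "'a :: idom"
  assumes t: "s = t + 2 * s\<^sup>2" and u: "u = x * (s * (1 - s)) + u\<^sup>2"
    and N: "N * (1 - u - s) = u * (1 - 2 * s - (1 - s) * u)"
    and N1: "N1 * (1 - 2 * s) = s * (1 - 3 * s + s\<^sup>2)"
    and nz: "s \<noteq> 0" "1 - s \<noteq> 0" "1 - u - s \<noteq> 0"
  shows "(x - 1) * (N - x * t) * (1 - N) = t * x\<^sup>2 * (N - N1)"
proof -
  define d where "d = 1 - u - s"
  define k where "k = s * (1 - s)"
  define r where "r = 1 - 3 * s + s\<^sup>2 - (1 - 2 * s) * u"
  have t': "t = s * (1 - 2 * s)" using t by algebra
  have kx: "k * x = u * (1 - u)" using u unfolding k_def by algebra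
  have 1: "k * (x - 1) = (u - s) * d" using kx unfolding k_def d_def by algebra
  have 2: "(1 - s) * d * (N - x * t) = u\<^sup>2 * r"
    using N kx unfolding d_def k_def r_def t' by algebra
  have 3: "d * (1 - N) = (1 - s) * (1 - u)\<^sup>2"
    using N unfolding d_def by algebra
  have 4: "(1 - 2 * s) * d * (N - N1) = (u - s) * (1 - s) * r"
    using N N1 unfolding d_def r_def by algebra
  have "(k * (1 - s) * d * d) * ((x - 1) * (N - x * t) * (1 - N)) =
      (k * (x - 1)) * ((1 - s) * d * (N - x * t)) * (d * (1 - N))" by algebra
  also have "\<dots> = d * (1 - s) * (u * (1 - u))\<^sup>2 * ((u - s) * r)"
    unfolding 1 2 3 by algebra
  also have "\<dots> = d * (k * x)\<^sup>2 * ((u - s) * (1 - s) * r)"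
    unfolding kx by algebra
  also have "\<dots> = d * (k * x)\<^sup>2 * ((1 - 2 * s) * d * (N - N1))" unfolding 4 ..
  also have "\<dots> = (k * (1 - s) * d * d) * (t * x\<^sup>2 * (N - N1))"
    unfolding k_def t' by algebra
  finally show ?thesis using nz by (simp add: k_def d_def)
qed

lemma isCont_fps_mult:
  fixes F G :: "real \<Rightarrow> real fps"
  assumes "\<And>n. isCont (\<lambda>x. fps_nth (F x) n) a" "\<And>n. isCont (\<lambda>x. fps_nth (G x) n) a"
  shows "isCont (\<lambda>x. fps_nth (F x * G x) n) a"
  unfolding fps_mult_nth using assms by (intro continuous_intros)

lemma isCont_fps_quotient:
  fixes F G H :: "real \<Rightarrow> real fps"
  assumes F: "\<And>n. isCont (\<lambda>x. fps_nth (F x) n) a" and G: "\<And>n. isCont (\<lambda>x. fps_nth (G x) n) a"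
    and eq: "\<And>x. H x * G x = F x" and G0: "\<And>x. fps_nth (G x) 0 = 1"
  shows "isCont (\<lambda>x. fps_nth (H x) n) a"
proof (induction n rule: less_induct)
  case (less n)
  have H: "fps_nth (H x) n = fps_nth (F x) n - (\<Sum>i<n. fps_nth (H x) i * fps_nth (G x) (n - i))" for x
  proof -
    have "fps_nth (F x) n = (\<Sum>i\<in>insert n {..<n}. fps_nth (H x) i * fps_nth (G x) (n - i))"
      unfolding eq[symmetric] fps_mult_nth by (rule sum.cong) auto
    then show ?thesis by (simp add: G0)
  qed
  show ?case unfolding H using less F G by (intro continuous_intros) auto
qed

lemma isCont_u_fps: "isCont (\<lambda>x. fps_nth (u_fps x) n) a"
  by (simp add: u_fps_def fps_compose_nth power_mult_distrib fps_const_power)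

lemma isCont_solution: "isCont (\<lambda>x. fps_nth (solution x) n) a"
proof (rule isCont_fps_quotient[OF _ _ solution_mult])
  have "isCont (\<lambda>x. fps_nth (1 - 2 * s_fps - (1 - s_fps) * u_fps x) n) a" for n
    using isCont_fps_mult[where F = "\<lambda>_. 1 - s_fps" and G = u_fps] isCont_u_fps
    by (auto simp: fps_sub_nth intro!: continuous_intros)
  then show "isCont (\<lambda>x. fps_nth (u_fps x * (1 - 2 * s_fps - (1 - s_fps) * u_fps x)) n) a" for n
    by (intro isCont_fps_mult isCont_u_fps)
  show "isCont (\<lambda>x. fps_nth (1 - u_fps x - s_fps) n) a" for n
    using isCont_u_fps by (auto simp: fps_sub_nth intro!: continuous_intros)
qed simp

lemma solution_solves: "solves_catalytic_equation solution"
  unfolding solves_catalytic_equation_def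
proof (intro conjI allI)
  fix x
  show "fps_nth (solution x) 0 = 0" by (simp add: solution_def)
  have "fps_nth s_fps (Suc 0) \<noteq> 0" by (simp add: s_fps_nth)
  then have "s_fps \<noteq> 0" by (metis fps_zero_nth)
  moreover have "fps_nth (1 - s_fps) 0 \<noteq> 0" by simp
  then have "1 - s_fps \<noteq> 0" by (metis fps_zero_nth)
  moreover have "fps_nth (1 - u_fps x - s_fps) 0 \<noteq> 0" by simp
  then have "1 - u_fps x - s_fps \<noteq> 0" by (metis fps_zero_nth)
  ultimately have "(fps_const x - 1) * (solution x - fps_const x * fps_X) * (1 - solution x) =
      fps_X * (fps_const x)\<^sup>2 * (solution x - solution 1)"
    by (rule catalytic_identity[OF s_fps_eq u_fps_eq solution_mult solution_at_1])
  then show "fps_const (x - 1) * (solution x - fps_const x * fps_X) * (1 - solution x) =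
      fps_X * fps_const (x\<^sup>2) * (solution x - solution 1)"
    by (simp add: fps_const_power flip: fps_const_sub)
qed (rule isCont_solution)

section \<open>The number of new intervals\<close>

text \<open>At \<open>x = 1\<close> the series \<open>u\<close> becomes \<open>s\<close>; reducing powers of \<open>s\<close> by \<open>t = s - 2 s\<^sup>2\<close> leaves an
  expression linear in \<open>s\<close>, whose coefficients are explicit.\<close>
lemma new_fps_at_1: "8 * (fps_X * new_fps 1) = fps_X - s_fps + 8 * (fps_X * s_fps) + 2 * fps_X\<^sup>2"
proof -
  have "new_fps 1 = solution 1"
    by (rule catalytic_equation_unique[OF new_fps_solves solution_solves])
  then have "new_fps 1 * (1 - 2 * s_fps) = s_fps * (1 - 3 * s_fps + s_fps\<^sup>2)"
    using solution_at_1 by simp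
  with s_fps_eq show ?thesis by algebra
qed

theorem mainTheorem2:
  fixes n :: nat
  assumes "n \<ge> 2"
  shows "real (card (new_intervals n)) =
    3 * (2 ^ (n - 2) * fact (2 * n - 2)) / (fact (n - 1) * fact (n + 1))"
proof -
  obtain k where n: "n = Suc (Suc k)" using assms by (metis add_2_eq_Suc le_Suc_ex)
  have "fps_nth (8 * (fps_X * new_fps 1)) (Suc n) = 8 * real (card (new_intervals n))"
    using n by (simp add: numeral_fps_const new_fps_def)
  moreover have "fps_nth (fps_X - s_fps + 8 * (fps_X * s_fps) + 2 * fps_X\<^sup>2) (Suc n) =
      8 * fps_nth s_fps n - fps_nth s_fps (Suc n)"
    using n by (simp add: numeral_fps_const fps_X_power_iff)
  ultimately have "8 * real (card (new_intervals n)) = 8 * fps_nth s_fps n - fps_nth s_fps (Suc n)"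
    using new_fps_at_1 by simp
  then have "real (card (new_intervals n)) = fps_nth s_fps (Suc (Suc k)) - fps_nth s_fps (Suc (Suc (Suc k))) / 8"
    by (simp add: n)
  also have "\<dots> = 2 ^ Suc k * fact (2 * Suc k) / (fact (Suc k) * fact (Suc (Suc k))) -
     2 ^ Suc (Suc k) * fact (2 * Suc (Suc k)) / (fact (Suc (Suc k)) * fact (Suc (Suc (Suc k)))) / 8"
    by (simp only: s_fps_nth)
  also have "\<dots> = 3 * (2 ^ k * fact (2 * Suc k)) / (fact (Suc k) * fact (Suc (Suc (Suc k))))"
  proof -
    define P f K :: real where "P = fact (2 * Suc k)" and "f = fact (Suc k)" and "K = real k"
    have facts: "fact (2 * Suc (Suc k)) = (2 * K + 4) * ((2 * K + 3) * P)"
      "fact (Suc (Suc k)) = (K + 2) * f" "fact (Suc (Suc (Suc k))) = (K + 3) * ((K + 2) * f)"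
      by (simp_all add: P_def f_def K_def algebra_simps)
    have "f \<noteq> 0" "K + 2 \<noteq> 0" "K + 3 \<noteq> 0" by (simp_all add: f_def K_def add_nonneg_eq_0_iff)
    then show ?thesis
      unfolding facts P_def[symmetric] f_def[symmetric] power_Suc by (simp add: divide_simps) algebra
  qed
  finally show ?thesis by (simp add: n)
qed

end
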